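(* Let $r\ge 1$ and $e\in\{1,-1\}$. (I) On the modified $q$-Weyl algebra $\mathbf A_q^{\jmath}$ (the case $n=2r$) there exist automorphisms $T'_{i,e}$ and $T''_{i,-e}$ for $i\in\{1,\dots,r\}$ satisfying, for $j\in\{1,\dots,r+1\}$: $$T'_{i,e}(\mathfrak m_j)=T''_{i,-e}(\mathfrak m_j)=\begin{cases}\mathfrak m_i,&i\ne r,\ j=i+1,\\ \mathfrak m_{i+1},&i\neq r,\ j=i,\\ \mathfrak m_j,&\text{otherwise,}\end{cases}$$ $$T'_{i,e}(\mathfrak d_j)=\begin{cases}q^{e}\mathfrak m_r^{-2e}\mathfrak d_{r+1},&i=r,\ j=r+1,\\ q^{-2e}\mathfrak m_r^{-e}\mathfrak m_{r+1}^{-e}\mathfrak d_r,&i=j=r,\\ -q^{-e}\mathfrak m_{i+1}^{-e}\mathfrak d_i,&i\ne r,\ j=i+1,\\ \mathfrak m_i^{-e}\mathfrak d_{i+1},&i=j\ne r,\\ \mathfrak d_j,&\text{otherwise,}\end{cases}\qquad T'_{i,e}(\mathfrak x_j)=\begin{cases}q^{-e}\mathfrak m_r^{2e}\mathfrak x_{r+1},&i=r,\ j=r+1,\\ q^{e}\mathfrak m_r^{e}\mathfrak m_{r+1}^{e}\mathfrak x_r,&i=j=r,\\ -q^{e}\mathfrak m_{i+1}^{e}\mathfrak x_i,&i\ne r,\ j=i+1,\\ \mathfrak m_i^{e}\mathfrak x_{i+1},&i=j\ne r,\\ \mathfrak x_j,&\text{otherwise,}\end{cases}$$ $$T''_{i,-e}(\mathfrak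 d_j)=\begin{cases}q^{-e}\mathfrak m_r^{2e}\mathfrak d_{r+1},&i=r,\ j=r+1,\\ q^{2e}\mathfrak m_r^{e}\mathfrak m_{r+1}^{e}\mathfrak d_r,&i=j=r,\\ \mathfrak m_{i+1}^{e}\mathfrak d_i,&i\ne r,\ j=i+1,\\ -q^{e}\mathfrak m_i^{e}\mathfrak d_{i+1},&i=j\ne r,\\ \mathfrak d_j,&\text{otherwise,}\end{cases}\qquad T''_{i,-e}(\mathfrak x_j)=\begin{cases}q^{e}\mathfrak m_r^{-2e}\mathfrak x_{r+1},&i=r,\ j=r+1,\\ q^{-e}\mathfrak m_r^{-e}\mathfrak m_{r+1}^{-e}\mathfrak x_r,&i=j=r,\\ \mathfrak m_{i+1}^{-e}\mathfrak x_i,&i\ne r,\ j=i+1,\\ -q^{-e}\mathfrak m_i^{-e}\mathfrak x_{i+1},&i=j\ne r,\\ \mathfrak x_j,&\text{otherwise.}\end{cases}$$ (II) On the modified $q$-Weyl algebra $\mathbf A_q^{\imath}$ (the case $n=2r+1$) there exist automorphisms $T'_{i,e}$ and $T''_{i,-e}$ for $i\in\{1,\dots,r+1\}$ satisfying, for $j\in\{1,\dots,r+1\}$: $$T'_{i,e}(\mathfrak m_j)=T''_{i,-e}(\mathfrak m_j)=\begin{cases}\mathfrak m_i,&j=i+1,\\ \mathfrak m_{i+1},&j=i\ne r+1,\\ \mathfrak m_j,&\text{otherwise,}\end{cases}$$ $$T'_{i,e}(\mathfrak d_j)=\begin{cases}\mathfrak m_{r+1}^{-e}\mathfrak d_{r+1},&i=j=r+1,\\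 -q^{-e}\mathfrak m_{i+1}^{-e}\mathfrak d_i,&j=i+1,\\ \mathfrak m_i^{-e}\mathfrak d_{i+1},&i=j\ne r+1,\\ \mathfrak d_j,&\text{otherwise,}\end{cases}\qquad T'_{i,e}(\mathfrak x_j)=\begin{cases}q^{-e}\mathfrak m_{r+1}^{e}\mathfrak x_{r+1},&i=j=r+1,\\ -q^{e}\mathfrak m_{i+1}^{e}\mathfrak x_i,&j=i+1,\\ \mathfrak m_i^{e}\mathfrak x_{i+1},&i=j\ne r+1,\\ \mathfrak x_j,&\text{otherwise,}\end{cases}$$ $$T''_{i,-e}(\mathfrak d_j)=\begin{cases}\mathfrak m_{r+1}^{e}\mathfrak d_{r+1},&i=j=r+1,\\ \mathfrak m_{i+1}^{e}\mathfrak d_i,&j=i+1,\\ -q^{e}\mathfrak m_i^{e}\mathfrak d_{i+1},&i=j\ne r+1,\\ \mathfrak d_j,&\text{otherwise,}\end{cases}\qquad T''_{i,-e}(\mathfrak x_j)=\begin{cases}q^{e}\mathfrak m_{r+1}^{-e}\mathfrak x_{r+1},&i=j=r+1,\\ \mathfrak m_{i+1}^{-e}\mathfrak x_i,&j=i+1,\\ -q^{-e}\mathfrak m_i^{-e}\mathfrak x_{i+1},&i=j\ne r+1,\\ \mathfrak x_j,&\text{otherwise.}\end{cases}$$ Moreover, in both cases $T'_{i,e}T''_{i,-e}=T''_{i,-e}T'_{i,e}=\mathrm{id}$ for every admissible $i$.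
   Context: Fix an integer $r\ge1$ and let $n=2r$ or $n=2r+1$. Put $c_i=1$ for $1\le i\le r$, and $c_{r+1}=2$ if $n=2r$, $c_{r+1}=1$ if $n=2r+1$. The modified $q$-Weyl algebra is the unital associative $\mathbb Q(q)$-algebra generated by $\mathfrak d_i,\mathfrak x_i,\mathfrak m_i^{\pm1}$ ($1\le i\le r+1$) with relations: $\mathfrak m_i\mathfrak m_i^{-1}=\mathfrak m_i^{-1}\mathfrak m_i=1$ and $\mathfrak m_i\mathfrak m_j=\mathfrak m_j\mathfrak m_i$ for all $i,j$; $\mathfrak d_i\mathfrak m_j=\mathfrak m_j\mathfrak d_i$, $\mathfrak x_i\mathfrak m_j=\mathfrak m_j\mathfrak x_i$, $\mathfrak d_i\mathfrak x_j=\mathfrak x_j\mathfrak d_i$ for $i\ne j$; $\mathfrak d_i\mathfrak d_j=\mathfrak d_j\mathfrak d_i$, $\mathfrak x_i\mathfrak x_j=\mathfrak x_j\mathfrak x_i$ for all $i,j$; $\mathfrak d_i\mathfrak m_i=q^{c_i}\mathfrak m_i\mathfrak d_i$, $\mathfrak x_i\mathfrak m_i=q^{-c_i}\mathfrak m_i\mathfrak x_i$; $\mathfrak d_i\mathfrak x_i=\dfrac{q^{c_i}\mathfrak m_i-q^{-c_i}\mathfrak m_i^{-1}}{q-q^{-1}}$, $\mathfrak x_i\mathfrak d_i=\dfrac{\mathfrak m_i-\mathfrak m_i^{-1}}{q-q^{-1}}$. It is denoted $\mathbf A_q^{\jmath}$ when $n=2r$ and $\mathbf A_q^{\imath}$ when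 $n=2r+1$. Automorphisms are $\mathbb Q(q)$-algebra automorphisms. *)

theory Defs
  imports
    "HOL-Computational_Algebra.Polynomial"
    "HOL-Computational_Algebra.Fraction_Field"
    "HOL-Library.Poly_Mapping"
    "HOL-Algebra.QuotRing"
    "HOL-Algebra.Module"
begin

type_synonym ratfun = "rat poly fract"

definition qq :: ratfun where
  "qq = Fract [:0, 1:] 1"

text \<open>
  The free monoid of words.  Concatenation is written additively (although it is not commutative),
  because convolution of finitely supported functions is defined for exponents in \<^class>\<open>monoid_add\<close>.
  Thus \<open>'g word \<Rightarrow>\<^sub>0 'k\<close> is the monoid algebra of the free monoid, i.e. the free unital
  associative \<open>'k\<close>-algebra on \<open>'g\<close>.
\<close>

datatype 'g word = Word (letters: "'g list")

instantiation word :: (type) monoid_add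
begin

definition zero_word :: "'a word" where
  "0 = Word []"

definition plus_word :: "'a word \<Rightarrow> 'a word \<Rightarrow> 'a word" where
  "u + v = Word (letters u @ letters v)"

instance
  by standard (simp_all add: zero_word_def plus_word_def)

end

type_synonym ('g, 'k) free_alg = "'g word \<Rightarrow>\<^sub>0 'k"

definition scal :: "'k::zero \<Rightarrow> ('g, 'k) free_alg" where
  "scal k = Poly_Mapping.single 0 k"

definition gen :: "'g \<Rightarrow> ('g, 'k::zero_neq_one) free_alg" where
  "gen g = Poly_Mapping.single (Word [g]) 1"

definition free_alg_on :: "'g set \<Rightarrow> ('g, 'k::ring_1) free_alg ring" where
  "free_alg_on G =
     \<lparr>carrier = {p. \<forall>w\<in>Poly_Mapping.keys p. set (letters w) \<subseteq> G},
      mult = (*), one = 1, zero = 0, add = (+)\<rparr>"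

lemma ring_free_alg_on: "ring (free_alg_on G :: ('g, 'k::ring_1) free_alg ring)"
proof (rule ringI)
  show "abelian_group (free_alg_on G :: ('g, 'k) free_alg ring)"
  proof (rule abelian_groupI)
    fix x :: "('g, 'k) free_alg"
    assume "x \<in> carrier (free_alg_on G)"
    then show "\<exists>y\<in>carrier (free_alg_on G). y \<oplus>\<^bsub>free_alg_on G\<^esub> x = \<zero>\<^bsub>free_alg_on G\<^esub>"
      by (intro bexI[of _ "- x"]) (auto simp: free_alg_on_def)
  next
    fix x y :: "('g, 'k) free_alg"
    assume "x \<in> carrier (free_alg_on G)" "y \<in> carrier (free_alg_on G)"
    then show "x \<oplus>\<^bsub>free_alg_on G\<^esub> y \<in> carrier (free_alg_on G)"
      using keys_add[of x y] by (fastforce simp: free_alg_on_def)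
  qed (auto simp: free_alg_on_def add_ac)
  show "Group.monoid (free_alg_on G :: ('g, 'k) free_alg ring)"
  proof (rule monoidI)
    fix x y :: "('g, 'k) free_alg"
    assume "x \<in> carrier (free_alg_on G)" "y \<in> carrier (free_alg_on G)"
    then show "x \<otimes>\<^bsub>free_alg_on G\<^esub> y \<in> carrier (free_alg_on G)"
      using keys_mult[of x y] by (fastforce simp: free_alg_on_def plus_word_def)
  qed (auto simp: free_alg_on_def zero_word_def mult.assoc)
qed (auto simp: free_alg_on_def algebra_simps)

text \<open>
  Two-sided quotient, made into a \<open>'k\<close>-algebra through the images of the constants.  The record type
  \<^typ>\<open>('a, 'b) module\<close> of the library is a ring with an additional scalar multiplication.
\<close>

definition presented_alg ::
    "'g set \<Rightarrow> (('g, 'k) free_alg \<times> ('g, 'k::ring_1) free_alg) set \<Rightarrow> ('k, ('g, 'k) free_alg set) module"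
  where
  "presented_alg G Rel =
     (let F = free_alg_on G; I = Idl\<^bsub>F\<^esub> {a - b | a b. (a, b) \<in> Rel}; Q = F Quot I in
      ring.extend Q (module.fields (\<lambda>k X. (I +>\<^bsub>F\<^esub> scal k) \<otimes>\<^bsub>Q\<^esub> X)))"

definition presented_gen ::
    "'g set \<Rightarrow> (('g, 'k) free_alg \<times> ('g, 'k::ring_1) free_alg) set \<Rightarrow> 'g \<Rightarrow> ('g, 'k) free_alg set"
  where
  "presented_gen G Rel g =
     (let F = free_alg_on G in (Idl\<^bsub>F\<^esub> {a - b | a b. (a, b) \<in> Rel}) +>\<^bsub>F\<^esub> gen g)"

definition alg_aut :: "('k, 'a) module \<Rightarrow> ('a \<Rightarrow> 'a) set" where
  "alg_aut A = {h \<in> ring_iso A A. \<forall>k. \<forall>a\<in>carrier A. h (k \<odot>\<^bsub>A\<^esub> a) = k \<odot>\<^bsub>A\<^esub> h a}"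


datatype weyl_gen = D nat | X nat | M nat | M_inv nat

definition weyl_gens :: "nat \<Rightarrow> weyl_gen set" where
  "weyl_gens r = (\<Union>i\<in>{1..r+1}. {D i, X i, M i, M_inv i})"

inductive_set weyl_rels ::
    "nat \<Rightarrow> (nat \<Rightarrow> nat) \<Rightarrow> ((weyl_gen, ratfun) free_alg \<times> (weyl_gen, ratfun) free_alg) set"
  for r :: nat and c :: "nat \<Rightarrow> nat"
where
  m_m_inv: "i \<in> {1..r+1} \<Longrightarrow> (gen (M i) * gen (M_inv i), 1) \<in> weyl_rels r c"
| m_inv_m: "i \<in> {1..r+1} \<Longrightarrow> (gen (M_inv i) * gen (M i), 1) \<in> weyl_rels r c"
| m_m: "\<lbrakk>i \<in> {1..r+1}; j \<in> {1..r+1}\<rbrakk> \<Longrightarrow>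
    (gen (M i) * gen (M j), gen (M j) * gen (M i)) \<in> weyl_rels r c"
| d_m: "\<lbrakk>i \<in> {1..r+1}; j \<in> {1..r+1}; i \<noteq> j\<rbrakk> \<Longrightarrow>
    (gen (D i) * gen (M j), gen (M j) * gen (D i)) \<in> weyl_rels r c"
| x_m: "\<lbrakk>i \<in> {1..r+1}; j \<in> {1..r+1}; i \<noteq> j\<rbrakk> \<Longrightarrow>
    (gen (X i) * gen (M j), gen (M j) * gen (X i)) \<in> weyl_rels r c"
| d_x: "\<lbrakk>i \<in> {1..r+1}; j \<in> {1..r+1}; i \<noteq> j\<rbrakk> \<Longrightarrow>
    (gen (D i) * gen (X j), gen (X j) * gen (D i)) \<in> weyl_rels r c"
| d_d: "\<lbrakk>i \<in> {1..r+1}; j \<in> {1..r+1}\<rbrakk> \<Longrightarrow>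
    (gen (D i) * gen (D j), gen (D j) * gen (D i)) \<in> weyl_rels r c"
| x_x: "\<lbrakk>i \<in> {1..r+1}; j \<in> {1..r+1}\<rbrakk> \<Longrightarrow>
    (gen (X i) * gen (X j), gen (X j) * gen (X i)) \<in> weyl_rels r c"
| d_m_same: "i \<in> {1..r+1} \<Longrightarrow>
    (gen (D i) * gen (M i), scal (qq ^ c i) * gen (M i) * gen (D i)) \<in> weyl_rels r c"
| x_m_same: "i \<in> {1..r+1} \<Longrightarrow>
    (gen (X i) * gen (M i), scal (inverse (qq ^ c i)) * gen (M i) * gen (X i)) \<in> weyl_rels r c"
| d_x_same: "i \<in> {1..r+1} \<Longrightarrow>
    (gen (D i) * gen (X i),
     scal (1 / (qq - inverse qq)) *
       (scal (qq ^ c i) * gen (M i) - scal (inverse (qq ^ c i)) * gen (M_inv i))) \<in> weyl_rels r c"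
| x_d_same: "i \<in> {1..r+1} \<Longrightarrow>
    (gen (X i) * gen (D i),
     scal (1 / (qq - inverse qq)) * (gen (M i) - gen (M_inv i))) \<in> weyl_rels r c"

type_synonym weyl_elt = "(weyl_gen, ratfun) free_alg set"

definition q_weyl :: "nat \<Rightarrow> (nat \<Rightarrow> nat) \<Rightarrow> (ratfun, weyl_elt) module" where
  "q_weyl r c = presented_alg (weyl_gens r) (weyl_rels r c)"

definition weyl_elt :: "nat \<Rightarrow> (nat \<Rightarrow> nat) \<Rightarrow> weyl_gen \<Rightarrow> weyl_elt" where
  "weyl_elt r c = presented_gen (weyl_gens r) (weyl_rels r c)"

definition c_even :: "nat \<Rightarrow> nat \<Rightarrow> nat" where  \<comment> \<open>\<open>n = 2 * r\<close>\<close>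
  "c_even r i = (if i = r + 1 then 2 else 1)"

definition c_odd :: "nat \<Rightarrow> nat \<Rightarrow> nat" where  \<comment> \<open>\<open>n = 2 * r + 1\<close>\<close>
  "c_odd r i = 1"


lemma weyl_rels_in_carrier:
  assumes "(a, b) \<in> weyl_rels r c"
  shows "a - b \<in> carrier (free_alg_on (weyl_gens r))"
proof -
  let ?F = "free_alg_on (weyl_gens r) :: (weyl_gen, ratfun) free_alg ring"
  interpret F: ring ?F by (rule ring_free_alg_on)
  have mult: "x * y \<in> carrier ?F" if "x \<in> carrier ?F" "y \<in> carrier ?F" for x y
    using F.m_closed[OF that] by (simp add: free_alg_on_def)
  have minus: "x - y \<in> carrier ?F" if "x \<in> carrier ?F" "y \<in> carrier ?F" for x y
  proof -
    have "- y \<in> carrier ?F"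
      using that(2) by (simp add: free_alg_on_def)
    from F.a_closed[OF that(1) this] show ?thesis
      by (simp add: free_alg_on_def)
  qed
  have one: "1 \<in> carrier ?F"
    using F.one_closed by (simp add: free_alg_on_def)
  have scal: "scal k \<in> carrier ?F" for k
    by (simp add: free_alg_on_def scal_def zero_word_def)
  have gen: "gen g \<in> carrier ?F" if "g \<in> weyl_gens r" for g
    using that by (simp add: free_alg_on_def gen_def)
  have g: "D i \<in> weyl_gens r" "X i \<in> weyl_gens r" "M i \<in> weyl_gens r" "M_inv i \<in> weyl_gens r"
    if "i \<in> {1..r+1}" for i
    using that by (auto simp: weyl_gens_def)
  show ?thesis
    using assms by cases (auto intro!: minus mult one scal gen g)
qed

lemma ring_q_weyl: "ring (q_weyl r c)"
proof -
  let ?F = "free_alg_on (weyl_gens r) :: (weyl_gen, ratfun) free_alg ring"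
  let ?S = "{a - b | a b. (a, b) \<in> weyl_rels r c}"
  interpret F: ring ?F by (rule ring_free_alg_on)
  have "ideal (Idl\<^bsub>?F\<^esub> ?S) ?F"
    by (rule F.genideal_ideal) (auto intro: weyl_rels_in_carrier)
  then interpret Q: ring "?F Quot (Idl\<^bsub>?F\<^esub> ?S)"
    by (rule ideal.quotient_is_ring)
  have flds: "carrier (q_weyl r c) = carrier (?F Quot (Idl\<^bsub>?F\<^esub> ?S))"
    "mult (q_weyl r c) = mult (?F Quot (Idl\<^bsub>?F\<^esub> ?S))"
    "one (q_weyl r c) = one (?F Quot (Idl\<^bsub>?F\<^esub> ?S))"
    "zero (q_weyl r c) = zero (?F Quot (Idl\<^bsub>?F\<^esub> ?S))"
    "add (q_weyl r c) = add (?F Quot (Idl\<^bsub>?F\<^esub> ?S))"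
    by (simp_all add: q_weyl_def presented_alg_def Let_def ring.defs)
  show ?thesis
  proof (rule ringI)
    show "abelian_group (q_weyl r c)"
    proof (rule abelian_groupI)
      fix x y z
      assume x: "x \<in> carrier (q_weyl r c)" and y: "y \<in> carrier (q_weyl r c)"
        and z: "z \<in> carrier (q_weyl r c)"
      show "x \<oplus>\<^bsub>q_weyl r c\<^esub> y \<oplus>\<^bsub>q_weyl r c\<^esub> z = x \<oplus>\<^bsub>q_weyl r c\<^esub> (y \<oplus>\<^bsub>q_weyl r c\<^esub> z)"
        using x y z unfolding flds by (rule Q.a_assoc)
    next
      fix x y
      assume x: "x \<in> carrier (q_weyl r c)" and y: "y \<in> carrier (q_weyl r c)"
      show "x \<oplus>\<^bsub>q_weyl r c\<^esub> y \<in> carrier (q_weyl r c)"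
        using x y unfolding flds by (rule Q.a_closed)
      show "x \<oplus>\<^bsub>q_weyl r c\<^esub> y = y \<oplus>\<^bsub>q_weyl r c\<^esub> x"
        using x y unfolding flds by (rule Q.a_comm)
    next
      fix x
      assume x: "x \<in> carrier (q_weyl r c)"
      show "\<zero>\<^bsub>q_weyl r c\<^esub> \<oplus>\<^bsub>q_weyl r c\<^esub> x = x"
        using x unfolding flds by (rule Q.l_zero)
      show "\<exists>y\<in>carrier (q_weyl r c). y \<oplus>\<^bsub>q_weyl r c\<^esub> x = \<zero>\<^bsub>q_weyl r c\<^esub>"
        using x unfolding flds by (intro bexI) (rule Q.l_neg, assumption, rule Q.a_inv_closed)
    qed (simp add: flds)
    show "Group.monoid (q_weyl r c)"
      by (rule monoidI) (simp_all add: flds Q.m_assoc)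
  qed (simp_all add: flds Q.l_distr Q.r_distr)
qed

lemma weyl_elt_in_carrier:
  assumes "g \<in> weyl_gens r"
  shows "weyl_elt r c g \<in> carrier (q_weyl r c)"
proof -
  let ?F = "free_alg_on (weyl_gens r) :: (weyl_gen, ratfun) free_alg ring"
  let ?S = "{a - b | a b. (a, b) \<in> weyl_rels r c}"
  interpret F: ring ?F by (rule ring_free_alg_on)
  interpret I: ideal "Idl\<^bsub>?F\<^esub> ?S" ?F
    by (rule F.genideal_ideal) (auto intro: weyl_rels_in_carrier)
  have "gen g \<in> carrier ?F"
    using assms by (simp add: free_alg_on_def gen_def)
  then show ?thesis
    using ring_hom_closed[OF I.rcos_ring_hom]
    by (simp add: weyl_elt_def presented_gen_def q_weyl_def presented_alg_def Let_def ring.defs)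
qed

end

theory Submission
  imports Defs "HOL-Combinatorics.Transposition"
begin

text \<open>
  Every automorphism in the theorem has the same shape.  Up to a permutation \<open>\<sigma>\<close> of the indices that
  preserves the \<open>c i\<close> (a transposition or the identity), it fixes the torus generated by the
  \<open>\<mm> i\<close> and rescales the other generators by Laurent monomials in the torus:
  \<open>\<dd> i \<mapsto> s i \<cdot> \<mm>\<^sup>-\<^sup>a \<cdot> \<dd> (\<sigma> i)\<close> and \<open>\<xx> i \<mapsto> t i \<cdot> \<mm>\<^sup>a \<cdot> \<xx> (\<sigma> i)\<close>, where \<open>s i\<close>, \<open>t i\<close> are scalars and
  the exponent vector \<open>a\<close> depends on \<open>i\<close>.

  Monomials commute with the torus, and moving \<open>\<dd> k\<close> or \<open>\<xx> k\<close> past a monomial costs a power of \<open>q\<close>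
  whose exponent is, up to sign, \<open>c k\<close> times the exponent of \<open>\<mm> k\<close> in it.  Comparing the two orders of a
  product, the images of commuting generators commute again as soon as the matrix of these exponents is
  symmetric, and the images of \<open>\<dd> i\<close> and \<open>\<xx> i\<close> have the products \<open>\<dd> (\<sigma> i) \<cdot> \<xx> (\<sigma> i)\<close> and
  \<open>\<xx> (\<sigma> i) \<cdot> \<dd> (\<sigma> i)\<close> as soon as one normalisation of \<open>s i * t i\<close> holds; the two products need the same
  power of \<open>q\<close>.  These conditions form the predicate \<open>twist_data\<close>, and \<open>twist_exists\<close> shows that they
  suffice for an endomorphism.

  The conditions are preserved when the scalars at \<open>\<sigma> i\<close> are inverted and the exponents at \<open>\<sigma> i\<close> are
  negated and relabelled by \<open>\<sigma>\<close>.  The endomorphism so obtained undoes the first one on generators and hence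
  everywhere;
  \<open>inverse_twists_exist\<close> packages this.  What remains is to exhibit the data: a transposition of two
  neighbouring indices with equal \<open>c\<close>, and for the last node a twist by the identity permutation, where the
  exponent matrix is a single diagonal entry if \<open>c (r + 1) = 1\<close>, and if \<open>c (r + 1) = 2\<close> has a diagonal
  entry at \<open>r\<close> and couples \<open>r\<close> with \<open>r + 1\<close> by the entries \<open>e\<close> and \<open>2 * e\<close>, the factor \<open>2\<close> making the
  matrix symmetric after multiplication with the \<open>c i\<close>.

  To get endomorphisms from images of generators, the free algebra and its quotients need their
  universal properties, \<open>free_ext_mult\<close> and \<open>alg_endo_exists\<close>.
\<close>

section \<open>Homomorphisms of free algebras\<close>

text \<open>The substitution homomorphism that sends each generator \<open>g\<close> to \<open>f g\<close>.\<close>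

definition free_ext :: "('g \<Rightarrow> ('h, 'k::comm_ring_1) free_alg) \<Rightarrow> ('g, 'k) free_alg \<Rightarrow> ('h, 'k) free_alg"
  where "free_ext f p =
    (\<Sum>w\<in>Poly_Mapping.keys p. scal (Poly_Mapping.lookup p w) * prod_list (map f (letters w)))"

lemma scal_add: "scal (a + b) = scal a + scal b"
  by (simp add: scal_def single_add)

lemma scal_mult: "scal (a * b) = scal a * scal b"
  by (simp add: scal_def mult_single)

lemma scal_0 [simp]: "scal 0 = 0"
  by (simp add: scal_def)

lemma scal_1 [simp]: "scal 1 = 1"
  by (simp add: scal_def)

lemma free_ext_superset:
  assumes "finite S" "Poly_Mapping.keys p \<subseteq> S"
  shows "free_ext f p = (\<Sum>w\<in>S. scal (Poly_Mapping.lookup p w) * prod_list (map f (letters w)))"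
  unfolding free_ext_def
  by (rule sum.mono_neutral_left) (use assms in \<open>auto simp: in_keys_iff\<close>)

lemma free_ext_add: "free_ext f (p + q) = free_ext f p + free_ext f q"
proof -
  let ?S = "Poly_Mapping.keys p \<union> Poly_Mapping.keys q"
  have "free_ext f r = (\<Sum>w\<in>?S. scal (Poly_Mapping.lookup r w) * prod_list (map f (letters w)))"
    if "Poly_Mapping.keys r \<subseteq> ?S" for r
    by (rule free_ext_superset) (use that in auto)
  from this[of p] this[of q] this[OF keys_add[of p q]] show ?thesis
    by (simp add: lookup_add scal_add distrib_right sum.distrib)
qed

lemma free_ext_single:
  "free_ext f (Poly_Mapping.single w k) = scal k * prod_list (map f (letters w))"
  by (cases "k = 0") (simp_all add: free_ext_def)

lemma free_ext_scal: "free_ext f (scal k) = scal k"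
  by (simp add: scal_def[of k] free_ext_single zero_word_def)

lemma free_ext_gen: "free_ext f (gen g) = f g"
  by (simp add: gen_def free_ext_single)

lemma poly_mapping_sum_singles:
  fixes p :: "'a \<Rightarrow>\<^sub>0 'b::comm_monoid_add"
  shows "p = (\<Sum>w\<in>Poly_Mapping.keys p. Poly_Mapping.single w (Poly_Mapping.lookup p w))"
  by (rule poly_mapping_eqI) (simp add: lookup_sum lookup_single when_def in_keys_iff)

text \<open>
  Only the monomials that occur in \<open>p\<close> have to be considered, so that the rule also applies to
  elements supported on words in a given set of generators.
\<close>

lemma poly_mapping_additive_induct [case_names zero single add]:
  fixes p :: "'a \<Rightarrow>\<^sub>0 'b::comm_monoid_add"
  assumes "P 0"
    and "\<And>w k. w \<in> Poly_Mapping.keys p \<Longrightarrow> P (Poly_Mapping.single w k)"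
    and "\<And>a b. P a \<Longrightarrow> P b \<Longrightarrow> P (a + b)"
  shows "P p"
proof -
  have "P (\<Sum>w\<in>S. Poly_Mapping.single w (Poly_Mapping.lookup p w))"
    if "finite S" "S \<subseteq> Poly_Mapping.keys p" for S
    using that by (induction S) (auto intro: assms)
  then have "P (\<Sum>w\<in>Poly_Mapping.keys p. Poly_Mapping.single w (Poly_Mapping.lookup p w))"
    by simp
  then show ?thesis by (simp flip: poly_mapping_sum_singles)
qed

lemma scal_central: "scal k * p = p * scal (k :: 'k::comm_ring_1)"
proof (induction p rule: poly_mapping_additive_induct)
  case (single w l)
  then show ?case by (simp add: scal_def mult_single mult.commute)
qed (simp_all add: algebra_simps)

text \<open>
  By additivity in both arguments it is enough to multiply two monomials; there concatenation of words
  turns into a product of substituted words, and the coefficients can be collected because they are central.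
\<close>

lemma free_ext_mult:
  fixes f :: "'g \<Rightarrow> ('h, 'k::comm_ring_1) free_alg"
  shows "free_ext f (p * q) = free_ext f p * free_ext f q"
proof (induction p rule: poly_mapping_additive_induct)
  case zero
  then show ?case by (simp add: free_ext_def)
next
  case (single v k)
  show ?case
  proof (induction q rule: poly_mapping_additive_induct)
    case zero
    then show ?case by (simp add: free_ext_def)
  next
    case (single w l)
    have "scal k * (scal l * (x * y)) = scal k * (x * (scal l * y))" for x y :: "('h, 'k) free_alg"
      by (simp add: scal_central[of l] mult.assoc)
    then show ?case
      by (simp add: mult_single free_ext_single plus_word_def scal_mult mult.assoc)
  next
    case (add a b)
    then show ?case by (simp add: distrib_left free_ext_add)
  qed
next
  case (add a b)
  then show ?case by (simp add: distrib_right free_ext_add)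
qed

lemma free_alg_on_simps:
  "mult (free_alg_on G) = (*)" "one (free_alg_on G) = 1"
  "zero (free_alg_on G) = 0" "add (free_alg_on G) = (+)"
  by (simp_all add: free_alg_on_def)

lemma scal_in_free_alg_on: "scal k \<in> carrier (free_alg_on G)"
  by (simp add: free_alg_on_def scal_def zero_word_def)

lemma gen_in_free_alg_on: "g \<in> G \<Longrightarrow> gen g \<in> carrier (free_alg_on G)"
  by (simp add: free_alg_on_def gen_def)

lemma free_alg_on_closed:
  fixes p q :: "('g, 'k::ring_1) free_alg"
  assumes "p \<in> carrier (free_alg_on G)" "q \<in> carrier (free_alg_on G)"
  shows "p + q \<in> carrier (free_alg_on G)" "p * q \<in> carrier (free_alg_on G)"
    "- q \<in> carrier (free_alg_on G)" "p - q \<in> carrier (free_alg_on G)"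
proof -
  interpret F: ring "free_alg_on G :: ('g, 'k) free_alg ring" by (rule ring_free_alg_on)
  show "p + q \<in> carrier (free_alg_on G)" "p * q \<in> carrier (free_alg_on G)"
    using F.a_closed[OF assms] F.m_closed[OF assms] by (simp_all add: free_alg_on_simps)
  show uminus: "- q \<in> carrier (free_alg_on G)"
    using assms(2) by (simp add: free_alg_on_def)
  show "p - q \<in> carrier (free_alg_on G)"
    using F.a_closed[OF assms(1) uminus] by (simp add: free_alg_on_simps)
qed

text \<open>
  The free algebra is generated by the scalars and the letters; two homomorphisms that agree on these
  are therefore equal.
\<close>

lemma free_alg_on_induct [consumes 1, case_names scal gen add mult]:
  fixes p :: "('g, 'k::ring_1) free_alg"
  assumes p: "p \<in> carrier (free_alg_on G)"
    and scal: "\<And>k. P (scal k)"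
    and gen: "\<And>g. g \<in> G \<Longrightarrow> P (gen g)"
    and add: "\<And>a b. a \<in> carrier (free_alg_on G) \<Longrightarrow> b \<in> carrier (free_alg_on G)
      \<Longrightarrow> P a \<Longrightarrow> P b \<Longrightarrow> P (a + b)"
    and mult: "\<And>a b. a \<in> carrier (free_alg_on G) \<Longrightarrow> b \<in> carrier (free_alg_on G)
      \<Longrightarrow> P a \<Longrightarrow> P b \<Longrightarrow> P (a * b)"
  shows "P p"
proof -
  define Q where "Q a \<longleftrightarrow> a \<in> carrier (free_alg_on G) \<and> P a" for a
  have Q_word: "Q (Poly_Mapping.single (Word gs) k)" if "set gs \<subseteq> G" for gs k
    using that
  proof (induction gs)
    case Nil
    then show ?case
      using scal[of k] scal_in_free_alg_on[of k G] by (simp add: Q_def scal_def zero_word_def)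
  next
    case (Cons g gs)
    have "Poly_Mapping.single (Word (g # gs)) k
        = gen g * (Poly_Mapping.single (Word gs) k :: ('g, 'k) free_alg)"
      by (simp add: gen_def mult_single plus_word_def)
    with Cons show ?case
      by (simp add: Q_def free_alg_on_closed(2) mult gen gen_in_free_alg_on)
  qed
  have "Q p"
  proof (induction p rule: poly_mapping_additive_induct)
    case zero
    then show ?case using scal[of 0] scal_in_free_alg_on[of 0 G] by (simp add: Q_def)
  next
    case (single w k)
    then have "set (letters w) \<subseteq> G" using p by (simp add: free_alg_on_def)
    from Q_word[OF this, of k] show ?case by simp
  next
    case (add a b)
    then show ?case by (simp add: Q_def free_alg_on_closed assms(4))
  qed
  then show ?thesis by (simp add: Q_def)
qed

lemma free_ext_closed:
  assumes "\<And>g. g \<in> G \<Longrightarrow> f g \<in> carrier (free_alg_on H)" "p \<in> carrier (free_alg_on G)"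
  shows "free_ext f p \<in> carrier (free_alg_on H)"
  using assms(2)
  by (induction rule: free_alg_on_induct)
    (simp_all add: free_ext_scal free_ext_gen free_ext_add free_ext_mult
      scal_in_free_alg_on free_alg_on_closed assms(1))

section \<open>Endomorphisms of presented algebras\<close>

definition rel_ideal ::
    "'g set \<Rightarrow> (('g, 'k) free_alg \<times> ('g, 'k::ring_1) free_alg) set \<Rightarrow> ('g, 'k) free_alg set"
  where "rel_ideal G Rel = Idl\<^bsub>free_alg_on G\<^esub> {a - b | a b. (a, b) \<in> Rel}"

definition alg_class ::
    "'g set \<Rightarrow> (('g, 'k) free_alg \<times> ('g, 'k::ring_1) free_alg) set
      \<Rightarrow> ('g, 'k) free_alg \<Rightarrow> ('g, 'k) free_alg set"
  where "alg_class G Rel p = rel_ideal G Rel +>\<^bsub>free_alg_on G\<^esub> p"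

locale presentation =
  fixes G :: "'g set" and Rel :: "(('g, 'k::comm_ring_1) free_alg \<times> ('g, 'k) free_alg) set"
  assumes rel_closed: "(a, b) \<in> Rel \<Longrightarrow> a \<in> carrier (free_alg_on G) \<and> b \<in> carrier (free_alg_on G)"
begin

abbreviation "F \<equiv> free_alg_on G :: ('g, 'k) free_alg ring"
abbreviation "A \<equiv> presented_alg G Rel"
abbreviation "cls \<equiv> alg_class G Rel"

sublocale F: ring F by (rule ring_free_alg_on)

lemma relators_closed: "{a - b | a b. (a, b) \<in> Rel} \<subseteq> carrier F"
  using rel_closed by (auto intro: free_alg_on_closed)

sublocale I: ideal "rel_ideal G Rel" F
  unfolding rel_ideal_def by (rule F.genideal_ideal[OF relators_closed])

lemma presented_alg_simps:
  "carrier A = carrier (F Quot rel_ideal G Rel)"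
  "mult A = mult (F Quot rel_ideal G Rel)"
  "one A = one (F Quot rel_ideal G Rel)"
  "zero A = zero (F Quot rel_ideal G Rel)"
  "add A = add (F Quot rel_ideal G Rel)"
  by (simp_all add: presented_alg_def rel_ideal_def Let_def ring.defs)

lemma smult_eq: "k \<odot>\<^bsub>A\<^esub> a = cls (scal k) \<otimes>\<^bsub>A\<^esub> a"
  by (simp add: presented_alg_def rel_ideal_def alg_class_def Let_def ring.defs module.defs)

lemma presented_gen_eq: "presented_gen G Rel g = cls (gen g)"
  by (simp add: presented_gen_def rel_ideal_def alg_class_def Let_def)

lemma ring_A: "ring A"
proof -
  interpret Q: ring "F Quot rel_ideal G Rel" by (rule I.quotient_is_ring)
  show ?thesis
    by (intro ringI abelian_groupI monoidI)
      (auto simp: presented_alg_simps Q.a_ac Q.m_assoc Q.l_distr Q.r_distr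
        intro: Q.l_neg Q.a_inv_closed)
qed

sublocale A: ring A by (rule ring_A)

lemma cls_hom: "cls \<in> ring_hom F A"
  using I.rcos_ring_hom unfolding alg_class_def ring_hom_def
  by (auto simp: presented_alg_simps)

lemma cls_simps:
  assumes "p \<in> carrier F" "q \<in> carrier F"
  shows "cls (p + q) = cls p \<oplus>\<^bsub>A\<^esub> cls q" "cls (p * q) = cls p \<otimes>\<^bsub>A\<^esub> cls q"
  using ring_hom_add[OF cls_hom assms] ring_hom_mult[OF cls_hom assms]
  by (simp_all add: free_alg_on_simps)

lemma cls_one: "cls 1 = \<one>\<^bsub>A\<^esub>"
  using ring_hom_one[OF cls_hom] by (simp add: free_alg_on_simps)

lemma cls_closed [simp]: "p \<in> carrier F \<Longrightarrow> cls p \<in> carrier A"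
  using ring_hom_closed[OF cls_hom] by blast

lemma carrier_A_E:
  assumes "a \<in> carrier A"
  obtains p where "p \<in> carrier F" "a = cls p"
  using assms unfolding presented_alg_simps FactRing_def A_RCOSETS_def' alg_class_def by auto

lemma minus_F:
  assumes "a \<in> carrier F" "b \<in> carrier F"
  shows "a \<ominus>\<^bsub>F\<^esub> b = a - b"
proof -
  have "\<ominus>\<^bsub>F\<^esub> b = - b"
    by (rule F.minus_equality)
      (use assms free_alg_on_closed(3)[of b G b] in \<open>simp_all add: free_alg_on_simps\<close>)
  then show ?thesis by (simp add: a_minus_def free_alg_on_simps)
qed

lemma cls_eq_iff:
  assumes "a \<in> carrier F" "b \<in> carrier F"
  shows "cls a = cls b \<longleftrightarrow> a - b \<in> rel_ideal G Rel"
  unfolding alg_class_def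
  using F.quotient_eq_iff_same_a_r_cos[OF I.is_ideal assms] minus_F[OF assms] by simp

lemma cls_rel:
  assumes "(a, b) \<in> Rel"
  shows "cls a = cls b"
proof -
  have "a - b \<in> rel_ideal G Rel"
    using F.genideal_self[OF relators_closed] assms unfolding rel_ideal_def by blast
  then show ?thesis
    using rel_closed[OF assms] by (simp add: cls_eq_iff)
qed

definition alg_endo :: "(('g, 'k) free_alg set \<Rightarrow> ('g, 'k) free_alg set) set" where
  "alg_endo = {T \<in> ring_hom A A. \<forall>k. \<forall>a\<in>carrier A. T (k \<odot>\<^bsub>A\<^esub> a) = k \<odot>\<^bsub>A\<^esub> T a}"

lemma alg_endo_scal:
  assumes "T \<in> alg_endo"
  shows "T (cls (scal k)) = cls (scal k)"
proof -
  have "cls (scal k) = k \<odot>\<^bsub>A\<^esub> \<one>\<^bsub>A\<^esub>"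
    by (simp add: smult_eq scal_in_free_alg_on)
  then show ?thesis
    using assms by (simp add: alg_endo_def ring_hom_one[where h = T and R = A and S = A])
qed

lemma alg_endo_comp: "S \<in> alg_endo \<Longrightarrow> T \<in> alg_endo \<Longrightarrow> S \<circ> T \<in> alg_endo"
  unfolding alg_endo_def by (auto intro: ring_hom_trans ring_hom_closed)

lemma alg_endo_eqI:
  assumes "S \<in> alg_endo" "T \<in> alg_endo"
    and "\<And>g. g \<in> G \<Longrightarrow> S (cls (gen g)) = T (cls (gen g))"
    and "a \<in> carrier A"
  shows "S a = T a"
proof -
  have ST: "S \<in> ring_hom A A" "T \<in> ring_hom A A"
    using assms(1,2) by (auto simp: alg_endo_def)
  have "S (cls p) = T (cls p)" if "p \<in> carrier F" for p
    using that
  proof (induction rule: free_alg_on_induct)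
    case (add a b)
    then show ?case using ST by (simp add: cls_simps ring_hom_add)
  next
    case (mult a b)
    then show ?case using ST by (simp add: cls_simps ring_hom_mult)
  qed (simp_all add: alg_endo_scal assms)
  then show ?thesis using assms(4) by (auto elim: carrier_A_E)
qed

lemma alg_endo_id: "(\<lambda>a. a) \<in> alg_endo"
  by (simp add: alg_endo_def ring_hom_def)

lemma alg_autI:
  assumes "S \<in> alg_endo" "T \<in> alg_endo"
    and "\<And>a. a \<in> carrier A \<Longrightarrow> S (T a) = a" "\<And>a. a \<in> carrier A \<Longrightarrow> T (S a) = a"
  shows "S \<in> alg_aut A"
proof -
  have "S \<in> carrier A \<rightarrow> carrier A" "T \<in> carrier A \<rightarrow> carrier A"
    using assms(1,2) by (auto simp: alg_endo_def ring_hom_def)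
  then have "bij_betw S (carrier A) (carrier A)"
    by (rule bij_betwI) (use assms in auto)
  with assms(1) show ?thesis
    by (simp add: alg_aut_def alg_endo_def ring_iso_def)
qed

text \<open>
  The second premise speaks of an unspecified homomorphism \<open>h\<close> with the prescribed values on generators,
  because by the homomorphism laws \<open>h a = h b\<close> then becomes an identity between the prescribed images and
  can be checked in the quotient, without representatives in the free algebra.  Given these identities,
  the kernel of \<open>h\<close> contains the relators, hence the ideal they generate, and \<open>h\<close> factors through
  the quotient.
\<close>

theorem alg_endo_exists:
  assumes img: "\<And>g. g \<in> G \<Longrightarrow> img g \<in> carrier A"
    and rels: "\<And>h a b. \<lbrakk>h \<in> ring_hom F A; \<And>k. h (scal k) = cls (scal k);
      \<And>g. g \<in> G \<Longrightarrow> h (gen g) = img g; (a, b) \<in> Rel\<rbrakk> \<Longrightarrow> h a = h b"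
  shows "\<exists>T\<in>alg_endo. \<forall>g\<in>G. T (cls (gen g)) = img g"
proof -
  have "\<exists>p. p \<in> carrier F \<and> cls p = img g" if "g \<in> G" for g
    using img[OF that] by (metis carrier_A_E)
  then obtain f where f: "\<And>g. g \<in> G \<Longrightarrow> f g \<in> carrier F" "\<And>g. g \<in> G \<Longrightarrow> cls (f g) = img g"
    by metis
  define h where "h p = cls (free_ext f p)" for p
  have h: "h \<in> ring_hom F A"
    by (rule ring_hom_memI)
      (simp_all add: h_def free_ext_closed[OF f(1)] free_alg_on_simps free_ext_add free_ext_mult
        cls_simps free_ext_scal[of f 1, simplified] cls_one)
  have h_scal: "h (scal k) = cls (scal k)" for k
    by (simp add: h_def free_ext_scal)
  have h_gen: "h (gen g) = img g" if "g \<in> G" for g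
    by (simp add: h_def free_ext_gen f that)
  interpret h: ring_hom_ring F A h
    by (rule ring_hom_ringI2) (rule ring_free_alg_on ring_A h)+
  have h_diff: "h (a - b) \<oplus>\<^bsub>A\<^esub> h b = h a" if "a \<in> carrier F" "b \<in> carrier F" for a b
    using h.hom_add[of "a - b" b] that by (simp add: free_alg_on_simps free_alg_on_closed)
  have kernel: "rel_ideal G Rel \<subseteq> a_kernel F A h"
    unfolding rel_ideal_def
  proof (rule F.genideal_minimal[OF h.kernel_is_ideal], safe)
    fix a b assume ab: "(a, b) \<in> Rel"
    note cl = rel_closed[OF ab]
    have "h (a - b) \<oplus>\<^bsub>A\<^esub> h b = h b"
      using h_diff[of a b] rels[OF h h_scal h_gen ab] cl by simp
    then have "h (a - b) = \<zero>\<^bsub>A\<^esub>"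
      using cl A.add.l_cancel_one'[of "h b" "h (a - b)"]
      by (simp add: A.a_comm free_alg_on_closed)
    then show "a - b \<in> a_kernel F A h"
      using free_alg_on_closed(4) cl unfolding a_kernel_def' by blast
  qed
  have h_cong: "h p = h q" if "cls p = cls q" "p \<in> carrier F" "q \<in> carrier F" for p q
  proof -
    have "h (p - q) = \<zero>\<^bsub>A\<^esub>"
      using that kernel unfolding a_kernel_def' by (auto simp: cls_eq_iff)
    then show ?thesis using h_diff[of p q] that(2,3) by simp
  qed
  define T where "T a = h (SOME p. p \<in> carrier F \<and> cls p = a)" for a
  have T: "T (cls p) = h p" if "p \<in> carrier F" for p
    unfolding T_def
    by (rule h_cong; use someI[of "\<lambda>q. q \<in> carrier F \<and> cls q = cls p" p] that in simp)
  have "T \<in> ring_hom A A"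
  proof (rule ring_hom_memI)
    show "T \<one>\<^bsub>A\<^esub> = \<one>\<^bsub>A\<^esub>"
      using T[OF F.one_closed] by (simp add: free_alg_on_simps cls_one flip: h.hom_one)
    fix a b assume "a \<in> carrier A" "b \<in> carrier A"
    then obtain p q where pq: "p \<in> carrier F" "a = cls p" "q \<in> carrier F" "b = cls q"
      by (metis carrier_A_E)
    show "T a \<in> carrier A" using pq by (simp add: T)
    have "T (cls (p * q)) = h p \<otimes>\<^bsub>A\<^esub> h q" "T (cls (p + q)) = h p \<oplus>\<^bsub>A\<^esub> h q"
      using pq h.hom_mult[of p q] h.hom_add[of p q]
      by (simp_all add: T free_alg_on_simps free_alg_on_closed)
    then show "T (a \<otimes>\<^bsub>A\<^esub> b) = T a \<otimes>\<^bsub>A\<^esub> T b" "T (a \<oplus>\<^bsub>A\<^esub> b) = T a \<oplus>\<^bsub>A\<^esub> T b"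
      using pq by (simp_all add: cls_simps T)
  qed
  then have "T \<in> alg_endo"
    by (auto simp: alg_endo_def smult_eq ring_hom_mult scal_in_free_alg_on T h_scal)
  moreover have "T (cls (gen g)) = img g" if "g \<in> G" for g
    using that by (simp add: T gen_in_free_alg_on h_gen)
  ultimately show ?thesis by blast
qed

end

section \<open>Powers of units, scalars and exponent vectors\<close>

lemma qq_nonzero [simp]: "qq \<noteq> 0"
  by (simp add: qq_def Zero_fract_def eq_fract)

lemma (in monoid) Units_nat_pow_closed [simp]:
  "u \<in> Units G \<Longrightarrow> u [^] (n::nat) \<in> Units G"
  by (induction n) simp_all

lemma (in monoid) Units_int_pow_closed [simp]:
  "u \<in> Units G \<Longrightarrow> u [^] (e::int) \<in> Units G"
  unfolding int_pow_def2 by (simp del: pow_nat)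

lemma (in monoid) Units_int_pow_inverse:
  assumes "u \<in> Units G"
  shows "u [^] (- e :: int) = inv (u [^] e)"
  using assms Units_nat_pow_closed[OF assms] unfolding int_pow_def2
  by (cases "e = 0") (auto simp del: pow_nat)

lemma (in presentation) scal_class_mult:
  "cls (scal (k * l)) = cls (scal k) \<otimes>\<^bsub>A\<^esub> cls (scal l)"
  by (simp add: scal_mult cls_simps scal_in_free_alg_on)

lemma (in presentation) scal_class_central:
  assumes "a \<in> carrier A"
  shows "a \<otimes>\<^bsub>A\<^esub> cls (scal k) = cls (scal k) \<otimes>\<^bsub>A\<^esub> a"
proof -
  obtain p where p: "p \<in> carrier F" "a = cls p" using assms by (rule carrier_A_E)
  then show ?thesis
    using scal_central[of k p] scal_in_free_alg_on[of k G] by (simp flip: cls_simps)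
qed

lemma weyl_rels_closed:
  assumes "(a, b) \<in> weyl_rels r c"
  shows "a \<in> carrier (free_alg_on (weyl_gens r)) \<and> b \<in> carrier (free_alg_on (weyl_gens r))"
proof -
  have one: "(1 :: (weyl_gen, ratfun) free_alg) \<in> carrier (free_alg_on (weyl_gens r))"
    using scal_in_free_alg_on[of 1] by simp
  have g: "D i \<in> weyl_gens r" "X i \<in> weyl_gens r" "M i \<in> weyl_gens r" "M_inv i \<in> weyl_gens r"
    if "i \<in> {1..r+1}" for i
    using that by (auto simp: weyl_gens_def)
  show ?thesis
    using assms
    by cases (simp_all add: one g free_alg_on_closed scal_in_free_alg_on gen_in_free_alg_on)
qed

text \<open>
  A Laurent monomial is encoded by a list of index-exponent pairs, repetitions allowed, so that
  one or two factors are written down directly and relabelling is a map.  The total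
  exponent of \<open>\<mm> j\<close> is \<open>expo ps j\<close>.
\<close>

type_synonym exponents = "(nat \<times> int) list"

fun expo :: "exponents \<Rightarrow> nat \<Rightarrow> int" where
  "expo [] j = 0"
| "expo ((p, e) # ps) j = (if p = j then e else 0) + expo ps j"

definition neg :: "exponents \<Rightarrow> exponents" where
  "neg ps = map (\<lambda>(p, e). (p, - e)) ps"

definition relabel :: "(nat \<Rightarrow> nat) \<Rightarrow> exponents \<Rightarrow> exponents" where
  "relabel \<sigma> ps = map (\<lambda>(p, e). (\<sigma> p, e)) ps"

lemma expo_neg [simp]: "expo (neg ps) j = - expo ps j"
  by (induction ps j rule: expo.induct) (auto simp: neg_def)

lemma expo_relabel: "(\<And>p. p \<in> fst ` set ps \<Longrightarrow> \<sigma> p = j \<longleftrightarrow> p = k) \<Longrightarrow> expo (relabel \<sigma> ps) j = expo ps k"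
  by (induction ps) (auto simp: relabel_def)

lemma neg_neg [simp]: "neg (neg ps) = ps"
  by (simp add: neg_def comp_def case_prod_unfold)

lemma relabel_neg: "relabel \<sigma> (neg ps) = neg (relabel \<sigma> ps)"
  by (simp add: neg_def relabel_def comp_def case_prod_unfold)

lemma fst_neg [simp]: "fst ` set (neg ps) = fst ` set ps"
  by (force simp: neg_def)

lemma fst_relabel [simp]: "fst ` set (relabel \<sigma> ps) = \<sigma> ` fst ` set ps"
  by (force simp: relabel_def)

section \<open>Calculation in the \<open>q\<close>-Weyl algebra\<close>

locale weyl_alg =
  fixes r :: nat and c :: "nat \<Rightarrow> nat"
begin

sublocale presentation "weyl_gens r" "weyl_rels r c"
  by standard (rule weyl_rels_closed)

definition index :: "nat set" where "index = {1..r+1}"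
abbreviation \<eta> :: "ratfun \<Rightarrow> weyl_elt" where "\<eta> k \<equiv> cls (scal k)"
abbreviation \<dd> :: "nat \<Rightarrow> weyl_elt" where "\<dd> i \<equiv> cls (gen (D i))"
abbreviation \<xx> :: "nat \<Rightarrow> weyl_elt" where "\<xx> i \<equiv> cls (gen (X i))"
abbreviation \<mm> :: "nat \<Rightarrow> weyl_elt" where "\<mm> i \<equiv> cls (gen (M i))"
abbreviation \<mm>_inv :: "nat \<Rightarrow> weyl_elt" where "\<mm>_inv i \<equiv> cls (gen (M_inv i))"
abbreviation mul (infixl "\<cdot>" 70) where "a \<cdot> b \<equiv> a \<otimes>\<^bsub>A\<^esub> b"

lemma gens_mem:
  "i \<in> index \<Longrightarrow> D i \<in> weyl_gens r" "i \<in> index \<Longrightarrow> X i \<in> weyl_gens r"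
  "i \<in> index \<Longrightarrow> M i \<in> weyl_gens r" "i \<in> index \<Longrightarrow> M_inv i \<in> weyl_gens r"
  by (auto simp: weyl_gens_def index_def)

lemma gens_F [simp]:
  "i \<in> index \<Longrightarrow> gen (D i) \<in> carrier F" "i \<in> index \<Longrightarrow> gen (X i) \<in> carrier F"
  "i \<in> index \<Longrightarrow> gen (M i) \<in> carrier F" "i \<in> index \<Longrightarrow> gen (M_inv i) \<in> carrier F"
  by (simp_all add: gens_mem gen_in_free_alg_on)

lemma scal_F [simp]: "scal k \<in> carrier F"
  by (rule scal_in_free_alg_on)

declare free_alg_on_closed(1,2) [simp]

text \<open>
  The \<open>NO_MATCH\<close> premise keeps two adjacent scalars from being exchanged forever by the simplifier.
\<close>

lemma eta_left_commute:
  assumes "NO_MATCH (\<eta> l) a" "a \<in> carrier A" "b \<in> carrier A"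
  shows "a \<cdot> (\<eta> k \<cdot> b) = \<eta> k \<cdot> (a \<cdot> b)"
  using assms scal_class_central[of a k] A.m_assoc[of a "\<eta> k" b] A.m_assoc[of "\<eta> k" a b] by simp

lemma eta_mult_left:
  assumes "b \<in> carrier A"
  shows "\<eta> k \<cdot> (\<eta> l \<cdot> b) = \<eta> (k * l) \<cdot> b"
  using assms by (simp add: scal_class_mult A.m_assoc)

declare cls_one [simp]

text \<open>
  All commutation rules with the torus have this form, with \<open>\<beta> = 1\<close> for commuting elements.  The relation
  is multiplicative in \<open>u\<close> and \<open>\<beta>\<close>, which reduces monomials to generators.
\<close>

definition skew :: "weyl_elt \<Rightarrow> weyl_elt \<Rightarrow> ratfun \<Rightarrow> bool" where
  "skew x u \<beta> \<longleftrightarrow> x \<cdot> u = \<eta> \<beta> \<cdot> (u \<cdot> x)"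

lemma skew_scal: "x \<in> carrier A \<Longrightarrow> skew x (\<eta> k) 1"
  by (simp add: skew_def scal_class_central)

lemma skew_one: "x \<in> carrier A \<Longrightarrow> skew x \<one>\<^bsub>A\<^esub> 1"
  by (simp add: skew_def)

lemma skew_mult:
  assumes "x \<in> carrier A" "u \<in> carrier A" "v \<in> carrier A"
    and "skew x u \<beta>" "skew x v \<gamma>"
  shows "skew x (u \<cdot> v) (\<beta> * \<gamma>)"
proof -
  have "x \<cdot> (u \<cdot> v) = (x \<cdot> u) \<cdot> v" using assms by (simp add: A.m_assoc)
  also have "\<dots> = \<eta> \<beta> \<cdot> (u \<cdot> (x \<cdot> v))" using assms by (simp add: skew_def A.m_assoc)
  also have "\<dots> = \<eta> (\<beta> * \<gamma>) \<cdot> (u \<cdot> v \<cdot> x)"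
    using assms by (simp add: skew_def A.m_assoc eta_left_commute eta_mult_left)
  finally show ?thesis by (simp add: skew_def)
qed

lemma skew_inv:
  assumes x: "x \<in> carrier A" and u: "u \<in> Units A" and "\<beta> \<noteq> 0" and sk: "skew x u \<beta>"
  shows "skew x (inv\<^bsub>A\<^esub> u) (inverse \<beta>)"
proof -
  let ?v = "inv\<^bsub>A\<^esub> u"
  have c: "u \<in> carrier A" "?v \<in> carrier A" using u by auto
  have "?v \<cdot> x = ?v \<cdot> (x \<cdot> u) \<cdot> ?v"
    using c x u by (simp add: A.m_assoc)
  also have "\<dots> = \<eta> \<beta> \<cdot> (?v \<cdot> u \<cdot> (x \<cdot> ?v))"
    using sk c x by (simp add: skew_def A.m_assoc eta_left_commute)
  also have "\<dots> = \<eta> \<beta> \<cdot> (x \<cdot> ?v)"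
    using c x u by simp
  finally have "\<eta> (inverse \<beta>) \<cdot> (?v \<cdot> x) = \<eta> (inverse \<beta> * \<beta>) \<cdot> (x \<cdot> ?v)"
    using c x by (simp add: eta_mult_left)
  then show ?thesis
    using \<open>\<beta> \<noteq> 0\<close> c x by (simp add: skew_def)
qed

text \<open>
  Negative powers of \<open>u\<close> are inverses of natural ones, so both signs come from \<open>skew_mult\<close> and
  \<open>skew_inv\<close>; this is why \<open>u\<close> has to be a unit and \<open>\<beta>\<close> nonzero.
\<close>

lemma skew_int_pow:
  assumes x: "x \<in> carrier A" and u: "u \<in> Units A" and "\<beta> \<noteq> 0" and sk: "skew x u \<beta>"
  shows "skew x (u [^]\<^bsub>A\<^esub> (e::int)) (\<beta> powi e)"
proof -
  have pow: "skew x (u [^]\<^bsub>A\<^esub> n) (\<beta> ^ n)" for n :: nat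
  proof (induction n)
    case (Suc n)
    then show ?case
      using skew_mult[OF x _ _ Suc sk] u by (simp add: mult.commute A.Units_closed)
  qed (simp add: skew_one x)
  show ?thesis
  proof (cases "e < 0")
    case True
    have "skew x (inv\<^bsub>A\<^esub> (u [^]\<^bsub>A\<^esub> nat (- e))) (inverse (\<beta> ^ nat (- e)))"
      by (rule skew_inv[OF x A.Units_nat_pow_closed[OF u] _ pow]) (use \<open>\<beta> \<noteq> 0\<close> in simp)
    with True show ?thesis
      by (simp only: int_pow_def2 power_int_def if_True power_inverse not_le[symmetric] if_False
          not_False_eq_True)
  next
    case False
    then have "0 \<le> e" by simp
    with False pow[of "nat e"] show ?thesis
      by (simp only: int_pow_def2 power_int_def if_False if_True)
  qed
qed

lemma skew_products_commute:
  assumes "x \<in> carrier A" "y \<in> carrier A" "u \<in> carrier A" "v \<in> carrier A"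
    and "skew x v \<beta>"
  shows "(u \<cdot> x) \<cdot> (v \<cdot> y) = \<eta> \<beta> \<cdot> (u \<cdot> v) \<cdot> (x \<cdot> y)"
proof -
  have "(u \<cdot> x) \<cdot> (v \<cdot> y) = u \<cdot> ((x \<cdot> v) \<cdot> y)"
    using assms by (simp add: A.m_assoc)
  also have "\<dots> = \<eta> \<beta> \<cdot> (u \<cdot> v) \<cdot> (x \<cdot> y)"
    using assms by (simp add: skew_def A.m_assoc eta_left_commute)
  finally show ?thesis .
qed

lemmas cls_weyl_rel = weyl_rels.intros[where r = r and c = c, folded index_def, THEN cls_rel]

lemma gens_A [simp]:
  assumes "i \<in> index"
  shows "\<dd> i \<in> carrier A" "\<xx> i \<in> carrier A" "\<mm> i \<in> carrier A" "\<mm>_inv i \<in> carrier A"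
  using assms by simp_all

lemma M_inverse:
  assumes "i \<in> index"
  shows "\<mm> i \<cdot> \<mm>_inv i = \<one>\<^bsub>A\<^esub>" "\<mm>_inv i \<cdot> \<mm> i = \<one>\<^bsub>A\<^esub>"
  using cls_weyl_rel(1,2)[OF assms] assms
  by (simp_all add: cls_simps cls_one)

lemma M_Units [simp]: 
  assumes "i \<in> index" shows "\<mm> i \<in> Units A"
  unfolding Units_def using M_inverse[OF assms] gens_A(3,4)[OF assms] by auto

lemma skew_M_M: "i \<in> index \<Longrightarrow> j \<in> index \<Longrightarrow> skew (\<mm> i) (\<mm> j) 1"
  using cls_weyl_rel(3)[of i j] by (simp add: cls_simps skew_def)

lemma skew_D_M:
  "i \<in> index \<Longrightarrow> j \<in> index \<Longrightarrow> skew (\<dd> i) (\<mm> j) (if j = i then qq powi c i else 1)"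
  using cls_weyl_rel(4)[of i j] cls_weyl_rel(9)[of i]
  by (auto simp: cls_simps skew_def A.m_assoc )

lemma skew_X_M:
  "i \<in> index \<Longrightarrow> j \<in> index \<Longrightarrow> skew (\<xx> i) (\<mm> j) (if j = i then qq powi (- int (c i)) else 1)"
  using cls_weyl_rel(5)[of i j] cls_weyl_rel(10)[of i]
  by (auto simp: cls_simps skew_def A.m_assoc power_int_minus )

lemma D_D: "i \<in> index \<Longrightarrow> j \<in> index \<Longrightarrow> \<dd> i \<cdot> \<dd> j = \<dd> j \<cdot> \<dd> i"
  using cls_weyl_rel(7)[of i j] by (simp add: cls_simps)

lemma X_X: "i \<in> index \<Longrightarrow> j \<in> index \<Longrightarrow> \<xx> i \<cdot> \<xx> j = \<xx> j \<cdot> \<xx> i"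
  using cls_weyl_rel(8)[of i j] by (simp add: cls_simps)

lemma D_X: "i \<in> index \<Longrightarrow> j \<in> index \<Longrightarrow> i \<noteq> j \<Longrightarrow> \<dd> i \<cdot> \<xx> j = \<xx> j \<cdot> \<dd> i"
  using cls_weyl_rel(6)[of i j] by (simp add: cls_simps)

text \<open>
  Writing differences as sums lets the relations with a difference on the right be transported by additivity
  and multiplicativity of homomorphisms alone.
\<close>

lemma diff_scal: "x - y = x + scal (- 1) * (y :: (weyl_gen, ratfun) free_alg)"
proof -
  have "scal (- 1) * y + y = scal (- 1 + 1) * y"
    by (simp only: scal_add distrib_right scal_1 mult_1)
  then show ?thesis by (simp add: algebra_simps eq_neg_iff_add_eq_0)
qed

lemma D_X_same:
  assumes "i \<in> index"
  shows "\<dd> i \<cdot> \<xx> i = \<eta> (1 / (qq - inverse qq)) \<cdot>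
    (\<eta> (qq ^ c i) \<cdot> \<mm> i \<oplus>\<^bsub>A\<^esub> \<eta> (- 1) \<cdot> (\<eta> (inverse (qq ^ c i)) \<cdot> \<mm>_inv i))"
  using cls_weyl_rel(11)[OF assms] assms
  by (simp add: cls_simps diff_scal[of "_ * _"])

lemma X_D_same:
  assumes "i \<in> index"
  shows "\<xx> i \<cdot> \<dd> i = \<eta> (1 / (qq - inverse qq)) \<cdot> (\<mm> i \<oplus>\<^bsub>A\<^esub> \<eta> (- 1) \<cdot> \<mm>_inv i)"
  using cls_weyl_rel(12)[OF assms] assms
  by (simp add: cls_simps diff_scal[of "gen _"])

fun mprod :: "exponents \<Rightarrow> weyl_elt" where
  "mprod [] = \<one>\<^bsub>A\<^esub>"
| "mprod ((p, e) # ps) = \<mm> p [^]\<^bsub>A\<^esub> e \<cdot> mprod ps"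

lemma M_pow_closed [simp]: "p \<in> index \<Longrightarrow> \<mm> p [^]\<^bsub>A\<^esub> (e::int) \<in> carrier A"
  by (intro A.Units_closed A.Units_int_pow_closed M_Units)

lemma mprod_closed [simp]: "fst ` set ps \<subseteq> index \<Longrightarrow> mprod ps \<in> carrier A"
  by (induction ps rule: mprod.induct) simp_all

text \<open>
  An element that skew-commutes with \<open>\<mm> i\<close> and commutes with the other \<open>\<mm> p\<close> only feels the exponent
  of \<open>\<mm> i\<close> in a monomial.
\<close>

lemma skew_mprod:
  assumes "x \<in> carrier A" "fst ` set ps \<subseteq> index" "\<beta> \<noteq> 0"
    and "\<And>p. p \<in> index \<Longrightarrow> skew x (\<mm> p) (if p = i then \<beta> else 1)"
  shows "skew x (mprod ps) (\<beta> powi expo ps i)"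
  using assms(2)
proof (induction ps rule: mprod.induct)
  case 1
  then show ?case by (simp add: skew_one assms(1))
next
  case (2 p e ps)
  have p: "p \<in> index" "fst ` set ps \<subseteq> index" using 2(2) by auto
  have "skew x (\<mm> p [^]\<^bsub>A\<^esub> e) ((if p = i then \<beta> else 1) powi e)"
    by (rule skew_int_pow) (use assms p in auto)
  from skew_mult[OF assms(1) _ _ this 2(1)[OF p(2)]] p assms(3)
  show ?case by (simp add: power_int_add split: if_splits)
qed

definition monomial :: "ratfun \<Rightarrow> exponents \<Rightarrow> weyl_elt" where
  "monomial s ps = \<eta> s \<cdot> mprod ps"

end

section \<open>Twists by monomials\<close>

lemma (in monoid) hom_Units_int_pow:
  assumes h: "h \<in> hom G G" "h \<one> = \<one>" and u: "u \<in> Units G"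
  shows "h (u [^] (e::int)) = h u [^] e"
proof -
  have cl: "h x \<in> carrier G" if "x \<in> carrier G" for x
    using h(1) that by (auto simp: hom_def)
  have pow: "h (u [^] n) = h u [^] n" for n :: nat
    using u h by (induction n) (simp_all add: hom_mult Units_closed)
  have inv: "h (inv x) = inv (h x)" if "x \<in> Units G" for x
    by (rule inv_unique') (use h that in \<open>auto simp: cl Units_closed simp flip: hom_mult[OF h(1)]\<close>)
  show ?thesis
    by (cases "e < 0")
      (simp_all only: int_pow_def2 if_True if_False pow inv Units_nat_pow_closed[OF u])
qed

context weyl_alg
begin

lemma skew_1_iff: "x \<in> carrier A \<Longrightarrow> u \<in> carrier A \<Longrightarrow> skew x u 1 \<longleftrightarrow> x \<cdot> u = u \<cdot> x"
  by (simp add: skew_def)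

text \<open>
  Commutation is the case \<open>\<beta> = 1\<close> of \<open>skew_mprod\<close>, with \<open>0\<close> in the place of the index \<open>i\<close>.
\<close>

lemma M_mprod:
  assumes "p \<in> index" "fst ` set ps \<subseteq> index"
  shows "\<mm> p \<cdot> mprod ps = mprod ps \<cdot> \<mm> p"
  using skew_mprod[of "\<mm> p" ps 1 0] skew_M_M assms by (simp add: skew_1_iff)

lemma mprod_commute:
  assumes "fst ` set ps \<subseteq> index" "fst ` set qs \<subseteq> index"
  shows "mprod ps \<cdot> mprod qs = mprod qs \<cdot> mprod ps"
  using skew_mprod[of "mprod ps" qs 1 0] M_mprod assms by (simp add: skew_1_iff)

lemma mprod_neg:
  assumes "fst ` set ps \<subseteq> index"
  shows "mprod (neg ps) \<cdot> mprod ps = \<one>\<^bsub>A\<^esub>"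
  using assms
proof (induction ps rule: mprod.induct)
  case (2 p e ps)
  have p: "p \<in> index" "fst ` set ps \<subseteq> index" "fst ` set (neg ps) \<subseteq> index" using 2(2) by auto
  let ?u = "\<mm> p [^]\<^bsub>A\<^esub> e"
  have u: "?u \<in> Units A" "inv\<^bsub>A\<^esub> ?u \<in> carrier A" "?u \<in> carrier A" using p by simp_all
  have "skew (mprod (neg ps)) ?u (1 powi e)"
    by (rule skew_int_pow) (use p M_mprod[OF p(1,3)] in \<open>simp_all add: skew_1_iff\<close>)
  then have comm: "mprod (neg ps) \<cdot> ?u = ?u \<cdot> mprod (neg ps)"
    using p by (simp add: skew_1_iff)
  have "mprod (neg ((p, e) # ps)) \<cdot> mprod ((p, e) # ps)
      = inv\<^bsub>A\<^esub> ?u \<cdot> ((mprod (neg ps) \<cdot> ?u) \<cdot> mprod ps)"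
    using p u(2) by (simp add: neg_def A.m_assoc A.Units_int_pow_inverse flip: fst_neg)
  also have "\<dots> = (inv\<^bsub>A\<^esub> ?u \<cdot> ?u) \<cdot> (mprod (neg ps) \<cdot> mprod ps)"
    unfolding comm using p u(2) by (simp only: A.m_assoc mprod_closed M_pow_closed A.m_closed)
  also have "\<dots> = \<one>\<^bsub>A\<^esub>" using u 2(1)[OF p(2)] by simp
  finally show ?case .
qed (simp add: neg_def)

lemma monomial_closed [simp]: "fst ` set ps \<subseteq> index \<Longrightarrow> monomial s ps \<in> carrier A"
  by (simp add: monomial_def)

lemma monomial_mult:
  assumes "fst ` set ps \<subseteq> index" "fst ` set qs \<subseteq> index"
  shows "monomial s ps \<cdot> monomial t qs = \<eta> (s * t) \<cdot> (mprod ps \<cdot> mprod qs)"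
  using assms by (simp add: monomial_def A.m_assoc eta_left_commute eta_mult_left mult.commute)

lemma monomial_commute:
  assumes "fst ` set ps \<subseteq> index" "fst ` set qs \<subseteq> index"
  shows "monomial s ps \<cdot> monomial t qs = monomial t qs \<cdot> monomial s ps"
  unfolding monomial_mult[OF assms] monomial_mult[OF assms(2,1)] mprod_commute[OF assms]
  by (simp only: mult.commute)

lemma monomial_neg:
  assumes "fst ` set ps \<subseteq> index"
  shows "monomial s (neg ps) \<cdot> monomial t ps = \<eta> (s * t)"
  using assms by (simp add: monomial_mult mprod_neg)

lemma monomial_neg_cancel:
  assumes "fst ` set ps \<subseteq> index" "s * t = 1" "x \<in> carrier A"
  shows "monomial s (neg ps) \<cdot> (monomial t ps \<cdot> x) = x"
  using monomial_neg[OF assms(1), of s t] assms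
  by (simp flip: A.m_assoc)

lemma skew_monomial:
  assumes "x \<in> carrier A" "fst ` set ps \<subseteq> index" "\<beta> \<noteq> 0"
    and "\<And>p. p \<in> index \<Longrightarrow> skew x (\<mm> p) (if p = i then \<beta> else 1)"
  shows "skew x (monomial s ps) (\<beta> powi expo ps i)"
  using skew_mult[OF assms(1) _ _ skew_scal skew_mprod[OF assms]] assms(1,2)
  by (simp add: monomial_def)

lemma skew_D_monomial:
  assumes "i \<in> index" "fst ` set ps \<subseteq> index"
  shows "skew (\<dd> i) (monomial s ps) (qq powi (int (c i) * expo ps i))"
  using skew_monomial[OF _ assms(2) _ skew_D_M[OF assms(1)], of s] assms(1)
  by (simp add: power_int_mult)

lemma skew_X_monomial:
  assumes "i \<in> index" "fst ` set ps \<subseteq> index"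
  shows "skew (\<xx> i) (monomial s ps) (qq powi (- (int (c i) * expo ps i)))"
  using skew_monomial[OF _ assms(2) _ skew_X_M[OF assms(1)], of s] assms(1)
  by (simp only: power_int_mult[symmetric] mult_minus_left) simp

lemma M_monomial:
  assumes "p \<in> index" "fst ` set ps \<subseteq> index"
  shows "\<mm> p \<cdot> monomial s ps = monomial s ps \<cdot> \<mm> p"
  using assms by (simp add: monomial_def eta_left_commute A.m_assoc M_mprod)

lemma alg_endo_monomial:
  assumes T: "T \<in> alg_endo" "\<And>p. p \<in> index \<Longrightarrow> \<sigma> p \<in> index \<and> T (\<mm> p) = \<mm> (\<sigma> p)"
    and ps: "fst ` set ps \<subseteq> index"
  shows "T (monomial s ps) = monomial s (relabel \<sigma> ps)"
proof -
  have hom: "T \<in> ring_hom A A" using T by (simp add: alg_endo_def)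
  then have "T \<in> hom A A" "T \<one>\<^bsub>A\<^esub> = \<one>\<^bsub>A\<^esub>"
    by (auto simp: ring_hom_def hom_def)
  note pow = A.hom_Units_int_pow[OF this M_Units]
  have "T (mprod ps) = mprod (relabel \<sigma> ps)"
    using ps
    by (induction ps rule: mprod.induct)
      (simp_all add: relabel_def \<open>T \<one>\<^bsub>A\<^esub> = \<one>\<^bsub>A\<^esub>\<close> ring_hom_mult[OF hom] pow T(2))
  then show ?thesis
    using ps by (simp add: monomial_def ring_hom_mult[OF hom] alg_endo_scal[OF T(1)])
qed

text \<open>
  The conditions on \<open>\<sigma>\<close>, the scalars and the exponents under which the twisted generators satisfy the
  defining relations.  With \<open>c (\<sigma> i) = c i\<close>, the power of \<open>q\<close> created by moving \<open>\<dd> (\<sigma> i)\<close>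
  past the monomial of \<open>\<xx> j\<close> has exponent \<open>c i * expo (a j) (\<sigma> i)\<close>: symmetry in \<open>i\<close> and \<open>j\<close> is what
  commuting images require, and for \<open>i = j\<close> the scalars must cancel it.
\<close>

definition twist_data ::
    "(nat \<Rightarrow> nat) \<Rightarrow> (nat \<Rightarrow> ratfun) \<Rightarrow> (nat \<Rightarrow> ratfun) \<Rightarrow> (nat \<Rightarrow> exponents) \<Rightarrow> bool" where
  "twist_data \<sigma> s t a \<longleftrightarrow>
    (\<forall>i\<in>index. \<sigma> i \<in> index \<and> \<sigma> (\<sigma> i) = i \<and> c (\<sigma> i) = c i \<and> fst ` set (a i) \<subseteq> index \<and>
      s i * t i * qq powi (int (c i) * expo (a i) (\<sigma> i)) = 1) \<and>
    (\<forall>i\<in>index. \<forall>j\<in>index. int (c i) * expo (a j) (\<sigma> i) = int (c j) * expo (a i) (\<sigma> j))"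

definition twists where
  "twists T \<sigma> s t a \<longleftrightarrow> T \<in> alg_endo \<and> (\<forall>i\<in>index. T (\<mm> i) = \<mm> (\<sigma> i) \<and>
    T (\<dd> i) = monomial (s i) (neg (a i)) \<cdot> \<dd> (\<sigma> i) \<and> T (\<xx> i) = monomial (t i) (a i) \<cdot> \<xx> (\<sigma> i))"

lemma skew_left_mult:
  assumes "x \<in> carrier A" "u \<in> carrier A" "m \<in> carrier A" "u \<cdot> m = m \<cdot> u" "skew x m \<beta>"
  shows "skew (u \<cdot> x) m \<beta>"
proof -
  have "(u \<cdot> x) \<cdot> m = \<eta> \<beta> \<cdot> ((u \<cdot> m) \<cdot> x)"
    using assms(1-3,5) by (simp add: skew_def A.m_assoc eta_left_commute)
  also have "\<dots> = \<eta> \<beta> \<cdot> (m \<cdot> (u \<cdot> x))"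
    using assms(1-4) by (simp add: A.m_assoc)
  finally show ?thesis by (simp add: skew_def)
qed

lemma weyl_gens_cases:
  assumes "g \<in> weyl_gens r"
  obtains i where "i \<in> index" "g \<in> {D i, X i, M i, M_inv i}"
  using assms unfolding weyl_gens_def index_def by blast

lemmas weyl_rel_cases [consumes 1, case_names m_m_inv m_inv_m m_m d_m x_m d_x d_d x_x
    d_m_same x_m_same d_x_same x_d_same] =
  weyl_rels.cases[where r = r and c = c, folded index_def]

text \<open>
  Each relation is reduced to the same relation at the indices \<open>\<sigma> i\<close>, \<open>\<sigma> j\<close> by moving the monomials
  \<open>u\<close> and \<open>v\<close> to the front.  For two generators at indices \<open>i\<close> and \<open>j\<close> the powers of \<open>q\<close> from both orders
  are \<open>q i j\<close> and \<open>q j i\<close> or their inverses, and agree by symmetry; for \<open>\<dd> i\<close> and \<open>\<xx> i\<close> they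
  are cancelled by the normalisation.
\<close>

lemma twist_exists:
  assumes "twist_data \<sigma> s t a"
  obtains T where "twists T \<sigma> s t a"
proof -
  have \<sigma>: "\<And>i. i \<in> index \<Longrightarrow> \<sigma> i \<in> index" "\<And>i. i \<in> index \<Longrightarrow> \<sigma> (\<sigma> i) = i"
    and c\<sigma>: "\<And>i. i \<in> index \<Longrightarrow> c (\<sigma> i) = c i"
    and a: "\<And>i. i \<in> index \<Longrightarrow> fst ` set (a i) \<subseteq> index"
    and norm: "\<And>i. i \<in> index \<Longrightarrow> s i * t i * qq powi (int (c i) * expo (a i) (\<sigma> i)) = 1"
    and sym: "\<And>i j. i \<in> index \<Longrightarrow> j \<in> index \<Longrightarrow>
      int (c i) * expo (a j) (\<sigma> i) = int (c j) * expo (a i) (\<sigma> j)"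
    using assms unfolding twist_data_def by auto
  have \<sigma>_inj: "\<sigma> i = \<sigma> j \<longleftrightarrow> i = j" if "i \<in> index" "j \<in> index" for i j
    using \<sigma>(2) that by metis
  define u where "u i = monomial (s i) (neg (a i))" for i
  define v where "v i = monomial (t i) (a i)" for i
  have a': "fst ` set (neg (a i)) \<subseteq> index" if "i \<in> index" for i using a[OF that] by simp
  have uv [simp]: "u i \<in> carrier A" "v i \<in> carrier A" if "i \<in> index" for i
    using a[OF that] by (simp_all add: u_def v_def)
  have uv_comm: "u i \<cdot> u j = u j \<cdot> u i" "u i \<cdot> v j = v j \<cdot> u i" "v i \<cdot> v j = v j \<cdot> v i"
    if "i \<in> index" "j \<in> index" for i j
    unfolding u_def v_def by (rule monomial_commute a a' that)+
  have M_uv: "\<mm> p \<cdot> u i = u i \<cdot> \<mm> p" "\<mm> p \<cdot> v i = v i \<cdot> \<mm> p" if "i \<in> index" "p \<in> index" for i p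
    unfolding u_def v_def by (rule M_monomial a a' that)+
  define q where "q i j = qq powi (int (c i) * expo (a j) (\<sigma> i))" for i j
  have q_sym: "q i j = q j i" if "i \<in> index" "j \<in> index" for i j
    using sym[OF that] by (simp add: q_def)
  have sk: "skew (\<dd> (\<sigma> i)) (u j) (inverse (q i j))" "skew (\<dd> (\<sigma> i)) (v j) (q i j)"
    "skew (\<xx> (\<sigma> i)) (u j) (q i j)" "skew (\<xx> (\<sigma> i)) (v j) (inverse (q i j))"
    if "i \<in> index" "j \<in> index" for i j
    using skew_D_monomial[OF \<sigma>(1)[OF that(1)] a[OF that(2)]] skew_D_monomial[OF \<sigma>(1)[OF that(1)] a'[OF that(2)]]
      skew_X_monomial[OF \<sigma>(1)[OF that(1)] a[OF that(2)]] skew_X_monomial[OF \<sigma>(1)[OF that(1)] a'[OF that(2)]] that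
    by (simp_all add: u_def v_def q_def c\<sigma> power_int_minus)
  have same: "(u i \<cdot> \<dd> (\<sigma> i)) \<cdot> (v i \<cdot> \<xx> (\<sigma> i)) = \<dd> (\<sigma> i) \<cdot> \<xx> (\<sigma> i)"
    "(v i \<cdot> \<xx> (\<sigma> i)) \<cdot> (u i \<cdot> \<dd> (\<sigma> i)) = \<xx> (\<sigma> i) \<cdot> \<dd> (\<sigma> i)" if i: "i \<in> index" for i
  proof -
    have "u i \<cdot> v i = \<eta> (s i * t i)"
      unfolding u_def v_def by (rule monomial_neg[OF a[OF i]])
    then have "\<eta> (q i i) \<cdot> (u i \<cdot> v i) = \<one>\<^bsub>A\<^esub>"
      using norm[OF i] by (simp add: q_def mult.commute flip: scal_class_mult)
    then show "(u i \<cdot> \<dd> (\<sigma> i)) \<cdot> (v i \<cdot> \<xx> (\<sigma> i)) = \<dd> (\<sigma> i) \<cdot> \<xx> (\<sigma> i)"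
      "(v i \<cdot> \<xx> (\<sigma> i)) \<cdot> (u i \<cdot> \<dd> (\<sigma> i)) = \<xx> (\<sigma> i) \<cdot> \<dd> (\<sigma> i)"
      using skew_products_commute[OF _ _ _ _ sk(2)[OF i i], of "\<xx> (\<sigma> i)" "u i"]
        skew_products_commute[OF _ _ _ _ sk(3)[OF i i], of "\<dd> (\<sigma> i)" "v i"]
        i \<sigma>(1) uv_comm(2)[OF i i] by simp_all
  qed
  have D_M: "skew (u i \<cdot> \<dd> (\<sigma> i)) (\<mm> (\<sigma> j)) (if i = j then qq powi c i else 1)"
    and X_M: "skew (v i \<cdot> \<xx> (\<sigma> i)) (\<mm> (\<sigma> j)) (if i = j then qq powi (- int (c i)) else 1)"
    if "i \<in> index" "j \<in> index" for i j
    using that \<sigma>(1) skew_D_M[of "\<sigma> i" "\<sigma> j"] skew_X_M[of "\<sigma> i" "\<sigma> j"] M_uv[of i "\<sigma> j"]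
    by (auto intro!: skew_left_mult simp: \<sigma>_inj c\<sigma>)
  define img where "img g = (case g of D i \<Rightarrow> u i \<cdot> \<dd> (\<sigma> i) | X i \<Rightarrow> v i \<cdot> \<xx> (\<sigma> i)
    | M i \<Rightarrow> \<mm> (\<sigma> i) | M_inv i \<Rightarrow> \<mm>_inv (\<sigma> i))" for g
  have img_closed: "img g \<in> carrier A" if "g \<in> weyl_gens r" for g
    using that by (rule weyl_gens_cases) (auto simp: img_def \<sigma>(1))
  have "\<exists>T\<in>alg_endo. \<forall>g\<in>weyl_gens r. T (cls (gen g)) = img g"
  proof (rule alg_endo_exists[where img = img, OF img_closed])
    fix h x y
    assume h: "h \<in> ring_hom F A" and h_scal: "\<And>k. h (scal k) = \<eta> k"
      and h_gen: "\<And>g. g \<in> weyl_gens r \<Longrightarrow> h (gen g) = img g"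
    have h_simps: "h (gen (D i)) = u i \<cdot> \<dd> (\<sigma> i)" "h (gen (X i)) = v i \<cdot> \<xx> (\<sigma> i)"
      "h (gen (M i)) = \<mm> (\<sigma> i)" "h (gen (M_inv i)) = \<mm>_inv (\<sigma> i)" if "i \<in> index" for i
      using that by (simp_all add: h_gen gens_mem img_def)
    have h_add: "h (p + p') = h p \<oplus>\<^bsub>A\<^esub> h p'" and h_mult: "h (p * p') = h p \<cdot> h p'"
      if "p \<in> carrier F" "p' \<in> carrier F" for p p'
      using ring_hom_add[OF h that] ring_hom_mult[OF h that] by (simp_all add: free_alg_on_simps)
    have h_one: "h 1 = \<one>\<^bsub>A\<^esub>" using ring_hom_one[OF h] by (simp add: free_alg_on_simps)
    note hs = h_simps h_add h_mult h_one h_scal \<sigma>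
    assume "(x, y) \<in> weyl_rels r c"
    then show "h x = h y"
    proof (cases rule: weyl_rel_cases)
      case (m_m_inv i)
      then show ?thesis by (simp add: hs M_inverse)
    next
      case (m_inv_m i)
      then show ?thesis by (simp add: hs M_inverse)
    next
      case (m_m i j)
      then show ?thesis using skew_M_M[of "\<sigma> i" "\<sigma> j"] by (simp add: hs skew_1_iff)
    next
      case (d_m i j)
      then show ?thesis using D_M[of i j] by (simp add: hs skew_1_iff)
    next
      case (x_m i j)
      then show ?thesis using X_M[of i j] by (simp add: hs skew_1_iff)
    next
      case (d_x i j)
      then show ?thesis
        using skew_products_commute[OF _ _ _ _ sk(2)[of i j], of "\<xx> (\<sigma> j)" "u i"]
          skew_products_commute[OF _ _ _ _ sk(3)[of j i], of "\<dd> (\<sigma> i)" "v j"]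
          D_X[of "\<sigma> i" "\<sigma> j"] uv_comm(2)[of i j] q_sym[of i j] by (simp add: hs \<sigma>_inj)
    next
      case (d_d i j)
      then show ?thesis
        using skew_products_commute[OF _ _ _ _ sk(1)[of i j], of "\<dd> (\<sigma> j)" "u i"]
          skew_products_commute[OF _ _ _ _ sk(1)[of j i], of "\<dd> (\<sigma> i)" "u j"]
          D_D[of "\<sigma> i" "\<sigma> j"] uv_comm(1)[of i j] q_sym[of i j] by (simp add: hs)
    next
      case (x_x i j)
      then show ?thesis
        using skew_products_commute[OF _ _ _ _ sk(4)[of i j], of "\<xx> (\<sigma> j)" "v i"]
          skew_products_commute[OF _ _ _ _ sk(4)[of j i], of "\<xx> (\<sigma> i)" "v j"]
          X_X[of "\<sigma> i" "\<sigma> j"] uv_comm(3)[of i j] q_sym[of i j] by (simp add: hs)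
    next
      case (d_m_same i)
      then show ?thesis using D_M[of i i] by (simp add: hs skew_def A.m_assoc)
    next
      case (x_m_same i)
      then show ?thesis using X_M[of i i] by (simp add: hs skew_def A.m_assoc power_int_minus)
    next
      case (d_x_same i)
      then show ?thesis
        using D_X_same[of "\<sigma> i"] same(1)[of i]
        by (simp add: diff_scal[of "_ * _"] hs c\<sigma>)
    next
      case (x_d_same i)
      then show ?thesis
        using X_D_same[of "\<sigma> i"] same(2)[of i]
        by (simp add: diff_scal[of "gen _"] hs)
    qed
  qed
  then obtain T where T: "T \<in> alg_endo" "\<And>g. g \<in> weyl_gens r \<Longrightarrow> T (cls (gen g)) = img g"
    by blast
  have "twists T \<sigma> s t a"
    using T gens_mem unfolding twists_def by (simp add: img_def u_def v_def)
  then show thesis by (rule that)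
qed

end

section \<open>Inverses of twists\<close>

definition inv_scalars :: "(nat \<Rightarrow> nat) \<Rightarrow> (nat \<Rightarrow> ratfun) \<Rightarrow> nat \<Rightarrow> ratfun" where
  "inv_scalars \<sigma> s i = inverse (s (\<sigma> i))"

definition inv_exponents :: "(nat \<Rightarrow> nat) \<Rightarrow> (nat \<Rightarrow> exponents) \<Rightarrow> nat \<Rightarrow> exponents" where
  "inv_exponents \<sigma> a i = neg (relabel \<sigma> (a (\<sigma> i)))"

context weyl_alg
begin

lemma twist_data_inverse:
  assumes "twist_data \<sigma> s t a"
  shows "twist_data \<sigma> (inv_scalars \<sigma> s) (inv_scalars \<sigma> t) (inv_exponents \<sigma> a)"
proof -
  have \<sigma>: "\<And>i. i \<in> index \<Longrightarrow> \<sigma> i \<in> index" "\<And>i. i \<in> index \<Longrightarrow> \<sigma> (\<sigma> i) = i"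
    and c\<sigma>: "\<And>i. i \<in> index \<Longrightarrow> c (\<sigma> i) = c i"
    and a: "\<And>i. i \<in> index \<Longrightarrow> fst ` set (a i) \<subseteq> index"
    and norm: "\<And>i. i \<in> index \<Longrightarrow> s i * t i * qq powi (int (c i) * expo (a i) (\<sigma> i)) = 1"
    and sym: "\<And>i j. i \<in> index \<Longrightarrow> j \<in> index \<Longrightarrow>
      int (c i) * expo (a j) (\<sigma> i) = int (c j) * expo (a i) (\<sigma> j)"
    using assms unfolding twist_data_def by auto
  have expo_inv: "expo (inv_exponents \<sigma> a j) (\<sigma> i) = - expo (a (\<sigma> j)) i"
    if "i \<in> index" "j \<in> index" for i j
  proof -
    have "expo (relabel \<sigma> (a (\<sigma> j))) (\<sigma> i) = expo (a (\<sigma> j)) i"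
    proof (rule expo_relabel)
      fix p assume "p \<in> fst ` set (a (\<sigma> j))"
      then have "p \<in> index" using a[OF \<sigma>(1)[OF that(2)]] by auto
      then show "\<sigma> p = \<sigma> i \<longleftrightarrow> p = i" using \<sigma>(2) that(1) by metis
    qed
    then show ?thesis by (simp add: inv_exponents_def)
  qed
  have norm': "inv_scalars \<sigma> s i * inv_scalars \<sigma> t i
      * qq powi (int (c i) * expo (inv_exponents \<sigma> a i) (\<sigma> i)) = 1" if i: "i \<in> index" for i
  proof -
    have "inverse (s (\<sigma> i) * t (\<sigma> i) * qq powi (int (c i) * expo (a (\<sigma> i)) i)) = 1"
      using norm[OF \<sigma>(1)[OF i]] by (simp add: \<sigma> c\<sigma> i)
    then show ?thesis
      by (simp add: inv_scalars_def expo_inv i power_int_minus mult.commute)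
  qed
  have sym': "int (c i) * expo (inv_exponents \<sigma> a j) (\<sigma> i)
      = int (c j) * expo (inv_exponents \<sigma> a i) (\<sigma> j)" if "i \<in> index" "j \<in> index" for i j
    using sym[of "\<sigma> i" "\<sigma> j"] that by (simp add: expo_inv \<sigma> c\<sigma>)
  have a': "fst ` set (inv_exponents \<sigma> a i) \<subseteq> index" if "i \<in> index" for i
    using a[OF \<sigma>(1)[OF that]] \<sigma>(1) by (auto simp: inv_exponents_def image_subset_iff)
  show ?thesis
    unfolding twist_data_def by (intro conjI ballI \<sigma> c\<sigma> a' norm' sym')
qed

text \<open>
  The generator \<open>M_inv i\<close> is the inverse of \<open>M i\<close> in the algebra, so its image is determined by that of
  \<open>M i\<close> and twists need not mention it.
\<close>

lemma alg_endo_fixes_M_inv: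
  assumes "T \<in> alg_endo" "i \<in> index" "T (\<mm> i) = \<mm> i"
  shows "T (\<mm>_inv i) = \<mm>_inv i"
proof -
  have hom: "T \<in> ring_hom A A" using assms(1) by (simp add: alg_endo_def)
  have cl: "T (\<mm>_inv i) \<in> carrier A" using hom assms(2) by (simp add: ring_hom_closed)
  have "T (\<mm>_inv i) \<cdot> \<mm> i = \<one>\<^bsub>A\<^esub>"
    using ring_hom_mult[OF hom, of "\<mm>_inv i" "\<mm> i"] ring_hom_one[OF hom] assms M_inverse by simp
  moreover have "T (\<mm>_inv i) = (T (\<mm>_inv i) \<cdot> \<mm> i) \<cdot> \<mm>_inv i"
    using cl assms(2) by (simp add: A.m_assoc M_inverse)
  ultimately show ?thesis using assms(2) by simp
qed

text \<open>
  The map \<open>T'\<close> turns the monomial introduced by \<open>T\<close> into its relabelling, which cancels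
  against the monomial that \<open>T'\<close> puts in front of the generator at \<open>\<sigma> i\<close>.
\<close>

lemma twists_cancel:
  assumes T: "twists T \<sigma> s t a" and T': "twists T' \<sigma> s' t' a'"
    and \<sigma>: "\<And>i. i \<in> index \<Longrightarrow> \<sigma> i \<in> index" "\<And>i. i \<in> index \<Longrightarrow> \<sigma> (\<sigma> i) = i"
    and a: "\<And>i. i \<in> index \<Longrightarrow> fst ` set (a i) \<subseteq> index"
    and s: "\<And>i. i \<in> index \<Longrightarrow> s i * s' (\<sigma> i) = 1"
    and t: "\<And>i. i \<in> index \<Longrightarrow> t i * t' (\<sigma> i) = 1"
    and a': "\<And>i. i \<in> index \<Longrightarrow> a' (\<sigma> i) = neg (relabel \<sigma> (a i))"
    and x: "x \<in> carrier A"
  shows "T' (T x) = x"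
proof -
  have endo: "T \<in> alg_endo" "T' \<in> alg_endo" and hom: "T' \<in> ring_hom A A"
    using T T' by (auto simp: twists_def alg_endo_def)
  have T'_monomial: "T' (monomial k ps) = monomial k (relabel \<sigma> ps)" if "fst ` set ps \<subseteq> index" for k ps
    by (rule alg_endo_monomial[OF endo(2) _ that]) (use T' \<sigma> in \<open>simp add: twists_def\<close>)
  have T_simps: "T (\<mm> i) = \<mm> (\<sigma> i)" "T (\<dd> i) = monomial (s i) (neg (a i)) \<cdot> \<dd> (\<sigma> i)"
    "T (\<xx> i) = monomial (t i) (a i) \<cdot> \<xx> (\<sigma> i)" if "i \<in> index" for i
    using T that by (auto simp: twists_def)
  have T'_simps: "T' (\<mm> i) = \<mm> (\<sigma> i)" "T' (\<dd> i) = monomial (s' i) (neg (a' i)) \<cdot> \<dd> (\<sigma> i)"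
    "T' (\<xx> i) = monomial (t' i) (a' i) \<cdot> \<xx> (\<sigma> i)" if "i \<in> index" for i
    using T' that by (auto simp: twists_def)
  have comp: "T' \<circ> T \<in> alg_endo" using endo by (intro alg_endo_comp)
  have gen: "T' (T (cls (gen g))) = cls (gen g)" if "g \<in> weyl_gens r" for g
    using that
  proof (rule weyl_gens_cases)
    fix i assume i: "i \<in> index" and g: "g \<in> {D i, X i, M i, M_inv i}"
    let ?b = "relabel \<sigma> (a i)"
    have b: "fst ` set ?b \<subseteq> index" using a[OF i] \<sigma>(1) by auto
    have M: "T' (T (\<mm> i)) = \<mm> i"
      using i by (simp add: T_simps T'_simps \<sigma>)
    have "T' (T (\<dd> i)) = monomial (s i) (neg ?b) \<cdot> (monomial (s' (\<sigma> i)) ?b \<cdot> \<dd> i)"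
      using i a[OF i]
      by (simp add: T_simps T'_simps T'_monomial ring_hom_mult[OF hom] \<sigma> a' relabel_neg)
    also have "\<dots> = \<dd> i" by (rule monomial_neg_cancel) (use b s i in auto)
    finally have D: "T' (T (\<dd> i)) = \<dd> i" .
    have "T' (T (\<xx> i)) = monomial (t i) (neg (neg ?b)) \<cdot> (monomial (t' (\<sigma> i)) (neg ?b) \<cdot> \<xx> i)"
      using i a[OF i] by (simp add: T_simps T'_simps T'_monomial ring_hom_mult[OF hom] \<sigma> a')
    also have "\<dots> = \<xx> i" by (rule monomial_neg_cancel) (use b t i in auto)
    finally have X: "T' (T (\<xx> i)) = \<xx> i" .
    from g D X M alg_endo_fixes_M_inv[OF comp i] show ?thesis by auto
  qed
  from alg_endo_eqI[OF comp alg_endo_id _ x] gen show ?thesis by simp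
qed

definition inverse_twists where
  "inverse_twists T T' \<sigma> s t a \<longleftrightarrow> T \<in> alg_aut A \<and> T' \<in> alg_aut A \<and>
    twists T \<sigma> s t a \<and> twists T' \<sigma> (inv_scalars \<sigma> s) (inv_scalars \<sigma> t) (inv_exponents \<sigma> a) \<and>
    (\<forall>x\<in>carrier A. T (T' x) = x \<and> T' (T x) = x)"

text \<open>
  Since \<open>\<sigma>\<close> is an involution on the indices, inverting the data twice gives the data back; so
  \<open>twists_cancel\<close> applies in both orders.
\<close>

theorem inverse_twists_exist:
  assumes "twist_data \<sigma> s t a"
  shows "\<exists>T T'. inverse_twists T T' \<sigma> s t a"
proof -
  have \<sigma>: "\<And>i. i \<in> index \<Longrightarrow> \<sigma> i \<in> index" "\<And>i. i \<in> index \<Longrightarrow> \<sigma> (\<sigma> i) = i"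
    and a: "\<And>i. i \<in> index \<Longrightarrow> fst ` set (a i) \<subseteq> index"
    using assms unfolding twist_data_def by auto
  have nz: "s i \<noteq> 0" "t i \<noteq> 0" if "i \<in> index" for i
    using assms that unfolding twist_data_def by force+
  obtain T where T: "twists T \<sigma> s t a"
    by (rule twist_exists[OF assms])
  obtain T' where
    T': "twists T' \<sigma> (inv_scalars \<sigma> s) (inv_scalars \<sigma> t) (inv_exponents \<sigma> a)"
    by (rule twist_exists[OF twist_data_inverse[OF assms]])
  have 1: "T' (T x) = x" if "x \<in> carrier A" for x
    by (rule twists_cancel[OF T T' \<sigma> a _ _ _ that])
      (simp_all add: inv_scalars_def inv_exponents_def \<sigma> nz)
  have relabel_twice: "relabel \<sigma> (relabel \<sigma> ps) = ps" if "fst ` set ps \<subseteq> index" for ps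
    using that \<sigma>(2) unfolding relabel_def by (induction ps) auto
  have 2: "T (T' x) = x" if "x \<in> carrier A" for x
  proof (rule twists_cancel[OF T' T \<sigma> _ _ _ _ that])
    fix i assume i: "i \<in> index"
    show "fst ` set (inv_exponents \<sigma> a i) \<subseteq> index"
      using a[OF \<sigma>(1)[OF i]] \<sigma>(1) by (auto simp: inv_exponents_def image_subset_iff)
    show "a (\<sigma> i) = neg (relabel \<sigma> (inv_exponents \<sigma> a i))"
      using relabel_twice[OF a[OF \<sigma>(1)[OF i]]] by (simp add: inv_exponents_def relabel_neg)
  qed (simp_all add: inv_scalars_def \<sigma> nz)
  have "T \<in> alg_endo" "T' \<in> alg_endo" using T T' by (auto simp: twists_def)
  then have "T \<in> alg_aut A" "T' \<in> alg_aut A"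
    using 1 2 by (auto intro: alg_autI)
  with T T' 1 2 show ?thesis unfolding inverse_twists_def by blast
qed

end

section \<open>The three kinds of braid automorphisms\<close>

text \<open>
  The exchange of neighbours: \<open>\<dd> i \<mapsto> \<mm> i\<^sup>-\<^sup>e \<cdot> \<dd> (i + 1)\<close> and
  \<open>\<dd> (i + 1) \<mapsto> - q\<^sup>-\<^sup>e \<cdot> \<mm> (i + 1)\<^sup>-\<^sup>e \<cdot> \<dd> i\<close>.  The monomial at \<open>j\<close> is a power of \<open>\<mm> j\<close> and meets
  generators at the other index only, so no power of \<open>q\<close> arises in the product of the images of
  \<open>\<dd> j\<close> and \<open>\<xx> j\<close>, and their scalars have to be inverse to each other.
\<close>

definition swap_exponents :: "nat \<Rightarrow> int \<Rightarrow> nat \<Rightarrow> exponents" where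
  "swap_exponents i e j = (if j = i \<or> j = i + 1 then [(j, e)] else [])"

definition swap_scalar :: "nat \<Rightarrow> int \<Rightarrow> nat \<Rightarrow> ratfun" where
  "swap_scalar i e j = (if j = i + 1 then - (qq powi e) else 1)"

text \<open>
  The last node for odd \<open>n\<close>: the index is twisted by itself, \<open>\<dd> i \<mapsto> \<mm> i\<^sup>-\<^sup>e \<cdot> \<dd> i\<close>, and the power \<open>q\<^sup>e\<close>
  from this is compensated in the image of \<open>\<xx> i\<close>.
\<close>

definition self_exponents :: "nat \<Rightarrow> int \<Rightarrow> nat \<Rightarrow> exponents" where
  "self_exponents i e j = (if j = i then [(i, e)] else [])"

definition self_scalar :: "nat \<Rightarrow> int \<Rightarrow> nat \<Rightarrow> ratfun" where
  "self_scalar i e j = (if j = i then qq powi (- e) else 1)"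

text \<open>
  The last node for even \<open>n\<close>, with \<open>i = r\<close>.  Since \<open>c (r + 1) = 2\<close>, the exponent \<open>e\<close> of
  \<open>\<mm> (r + 1)\<close> at the index \<open>r\<close> has to be matched by the exponent \<open>2 * e\<close> of \<open>\<mm> r\<close> at the index \<open>r + 1\<close>.
  The exponent \<open>e\<close> of \<open>\<mm> r\<close> at \<open>r\<close> itself produces \<open>q\<^sup>e\<close>, which the scalars \<open>q\<^sup>-\<^sup>2\<^sup>e\<close> and \<open>q\<^sup>e\<close> there
  compensate.
\<close>

definition pair_exponents :: "nat \<Rightarrow> int \<Rightarrow> nat \<Rightarrow> exponents" where
  "pair_exponents i e j =
    (if j = i then [(i, e), (i + 1, e)] else if j = i + 1 then [(i, 2 * e)] else [])"

definition pair_scalar_D :: "nat \<Rightarrow> int \<Rightarrow> nat \<Rightarrow> ratfun" where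
  "pair_scalar_D i e j =
    (if j = i then qq powi (- 2 * e) else if j = i + 1 then qq powi e else 1)"

definition pair_scalar_X :: "nat \<Rightarrow> int \<Rightarrow> nat \<Rightarrow> ratfun" where
  "pair_scalar_X i e j =
    (if j = i then qq powi e else if j = i + 1 then qq powi (- e) else 1)"

context weyl_alg
begin

lemma twist_data_swap:
  assumes "i \<in> index" "i + 1 \<in> index" "c i = c (i + 1)"
  shows "twist_data (transpose i (i + 1)) (swap_scalar i (- e)) (swap_scalar i e) (swap_exponents i e)"
  using assms unfolding twist_data_def
  by (auto simp: swap_exponents_def swap_scalar_def transpose_def power_int_minus)

lemma twist_data_self:
  assumes "i \<in> index" "c i = 1"
  shows "twist_data (\<lambda>j. j) (\<lambda>j. 1) (self_scalar i e) (self_exponents i e)"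
  using assms unfolding twist_data_def
  by (auto simp: self_exponents_def self_scalar_def power_int_minus)

lemma twist_data_pair:
  assumes "i \<in> index" "i + 1 \<in> index" "c i = 1" "c (i + 1) = 2"
  shows "twist_data (\<lambda>j. j) (pair_scalar_D i e) (pair_scalar_X i e) (pair_exponents i e)"
  using assms unfolding twist_data_def
  by (auto simp: pair_exponents_def pair_scalar_D_def pair_scalar_X_def
      simp flip: power_int_add)

lemma monomial_smult: "fst ` set ps \<subseteq> index \<Longrightarrow> x \<in> carrier A \<Longrightarrow> monomial s ps \<cdot> x = s \<odot>\<^bsub>A\<^esub> (mprod ps \<cdot> x)"
  by (simp add: monomial_def smult_eq A.m_assoc)

lemma one_smult: "x \<in> carrier A \<Longrightarrow> 1 \<odot>\<^bsub>A\<^esub> x = x"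
  by (simp add: smult_eq)


lemma inverse_twists_formulas:
  assumes "inverse_twists T T' \<sigma> s t a" "j \<in> index" "fst ` set (a j) \<subseteq> index"
    "fst ` set (relabel \<sigma> (a (\<sigma> j))) \<subseteq> index" "\<sigma> j \<in> index"
  shows "T (\<mm> j) = \<mm> (\<sigma> j)" "T' (\<mm> j) = \<mm> (\<sigma> j)"
    "T (\<dd> j) = s j \<odot>\<^bsub>A\<^esub> (mprod (neg (a j)) \<cdot> \<dd> (\<sigma> j))"
    "T (\<xx> j) = t j \<odot>\<^bsub>A\<^esub> (mprod (a j) \<cdot> \<xx> (\<sigma> j))"
    "T' (\<dd> j) = inverse (s (\<sigma> j)) \<odot>\<^bsub>A\<^esub> (mprod (relabel \<sigma> (a (\<sigma> j))) \<cdot> \<dd> (\<sigma> j))"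
    "T' (\<xx> j) = inverse (t (\<sigma> j)) \<odot>\<^bsub>A\<^esub> (mprod (neg (relabel \<sigma> (a (\<sigma> j)))) \<cdot> \<xx> (\<sigma> j))"
  using assms unfolding inverse_twists_def twists_def inv_scalars_def inv_exponents_def
  by (simp_all add: monomial_smult del: fst_relabel)

lemma swap_side_conditions:
  assumes "i \<in> index" "i + 1 \<in> index" "j \<in> index"
  shows "fst ` set (swap_exponents i e j) \<subseteq> index"
    "fst ` set (relabel (transpose i (i + 1)) (swap_exponents i e (transpose i (i + 1) j))) \<subseteq> index"
    "transpose i (i + 1) j \<in> index"
  using assms by (auto simp: swap_exponents_def transpose_def relabel_def)

lemma swap_formulas:
  assumes i: "i \<in> index" "i + 1 \<in> index" and j: "j \<in> index"
    and T: "inverse_twists T T' (transpose i (i + 1)) (swap_scalar i (- e)) (swap_scalar i e) (swap_exponents i e)"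
  shows "T (\<mm> j) = (if j = i + 1 then \<mm> i else if j = i then \<mm> (i + 1) else \<mm> j)"
    "T' (\<mm> j) = (if j = i + 1 then \<mm> i else if j = i then \<mm> (i + 1) else \<mm> j)"
    "T (\<dd> j) = (if j = i + 1 then (- (qq powi (- e))) \<odot>\<^bsub>A\<^esub> (\<mm> (i + 1) [^]\<^bsub>A\<^esub> (- e) \<cdot> \<dd> i)
      else if j = i then \<mm> i [^]\<^bsub>A\<^esub> (- e) \<cdot> \<dd> (i + 1) else \<dd> j)"
    "T (\<xx> j) = (if j = i + 1 then (- (qq powi e)) \<odot>\<^bsub>A\<^esub> (\<mm> (i + 1) [^]\<^bsub>A\<^esub> e \<cdot> \<xx> i)
      else if j = i then \<mm> i [^]\<^bsub>A\<^esub> e \<cdot> \<xx> (i + 1) else \<xx> j)"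
    "T' (\<dd> j) = (if j = i + 1 then \<mm> (i + 1) [^]\<^bsub>A\<^esub> e \<cdot> \<dd> i
      else if j = i then (- (qq powi e)) \<odot>\<^bsub>A\<^esub> (\<mm> i [^]\<^bsub>A\<^esub> e \<cdot> \<dd> (i + 1)) else \<dd> j)"
    "T' (\<xx> j) = (if j = i + 1 then \<mm> (i + 1) [^]\<^bsub>A\<^esub> (- e) \<cdot> \<xx> i
      else if j = i then (- (qq powi (- e))) \<odot>\<^bsub>A\<^esub> (\<mm> i [^]\<^bsub>A\<^esub> (- e) \<cdot> \<xx> (i + 1)) else \<xx> j)"
  using i j
  by (auto simp: inverse_twists_formulas[OF T j swap_side_conditions[OF i j]] transpose_def
      swap_exponents_def swap_scalar_def relabel_def neg_def one_smult power_int_minus)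

lemma self_side_conditions:
  assumes "i \<in> index"
  shows "fst ` set (self_exponents i e j) \<subseteq> index"
    "fst ` set (relabel (\<lambda>j. j) (self_exponents i e j)) \<subseteq> index"
  using assms by (auto simp: self_exponents_def relabel_def)

lemma self_formulas:
  assumes i: "i \<in> index" and j: "j \<in> index"
    and T: "inverse_twists T T' (\<lambda>j. j) (\<lambda>j. 1) (self_scalar i e) (self_exponents i e)"
  shows "T (\<mm> j) = \<mm> j" "T' (\<mm> j) = \<mm> j"
    "T (\<dd> j) = (if j = i then \<mm> i [^]\<^bsub>A\<^esub> (- e) \<cdot> \<dd> i else \<dd> j)"
    "T (\<xx> j) = (if j = i then qq powi (- e) \<odot>\<^bsub>A\<^esub> (\<mm> i [^]\<^bsub>A\<^esub> e \<cdot> \<xx> i) else \<xx> j)"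
    "T' (\<dd> j) = (if j = i then \<mm> i [^]\<^bsub>A\<^esub> e \<cdot> \<dd> i else \<dd> j)"
    "T' (\<xx> j) = (if j = i then qq powi e \<odot>\<^bsub>A\<^esub> (\<mm> i [^]\<^bsub>A\<^esub> (- e) \<cdot> \<xx> i) else \<xx> j)"
  using i j
  by (auto simp: inverse_twists_formulas[OF T j self_side_conditions[OF i] j]
      self_exponents_def self_scalar_def relabel_def neg_def one_smult power_int_minus)

lemma pair_side_conditions:
  assumes "i \<in> index" "i + 1 \<in> index"
  shows "fst ` set (pair_exponents i e j) \<subseteq> index"
    "fst ` set (relabel (\<lambda>j. j) (pair_exponents i e j)) \<subseteq> index"
  using assms by (auto simp: pair_exponents_def relabel_def)

lemma pair_formulas:
  assumes i: "i \<in> index" "i + 1 \<in> index" and j: "j \<in> index"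
    and T: "inverse_twists T T' (\<lambda>j. j) (pair_scalar_D i e) (pair_scalar_X i e) (pair_exponents i e)"
  shows "T (\<mm> j) = \<mm> j" "T' (\<mm> j) = \<mm> j"
    "T (\<dd> j) = (if j = i + 1 then qq powi e \<odot>\<^bsub>A\<^esub> (\<mm> i [^]\<^bsub>A\<^esub> (- 2 * e) \<cdot> \<dd> (i + 1))
      else if j = i then qq powi (- 2 * e) \<odot>\<^bsub>A\<^esub>
        (\<mm> i [^]\<^bsub>A\<^esub> (- e) \<cdot> \<mm> (i + 1) [^]\<^bsub>A\<^esub> (- e) \<cdot> \<dd> i) else \<dd> j)"
    "T (\<xx> j) = (if j = i + 1 then qq powi (- e) \<odot>\<^bsub>A\<^esub> (\<mm> i [^]\<^bsub>A\<^esub> (2 * e) \<cdot> \<xx> (i + 1))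
      else if j = i then qq powi e \<odot>\<^bsub>A\<^esub>
        (\<mm> i [^]\<^bsub>A\<^esub> e \<cdot> \<mm> (i + 1) [^]\<^bsub>A\<^esub> e \<cdot> \<xx> i) else \<xx> j)"
    "T' (\<dd> j) = (if j = i + 1 then qq powi (- e) \<odot>\<^bsub>A\<^esub> (\<mm> i [^]\<^bsub>A\<^esub> (2 * e) \<cdot> \<dd> (i + 1))
      else if j = i then qq powi (2 * e) \<odot>\<^bsub>A\<^esub>
        (\<mm> i [^]\<^bsub>A\<^esub> e \<cdot> \<mm> (i + 1) [^]\<^bsub>A\<^esub> e \<cdot> \<dd> i) else \<dd> j)"
    "T' (\<xx> j) = (if j = i + 1 then qq powi e \<odot>\<^bsub>A\<^esub> (\<mm> i [^]\<^bsub>A\<^esub> (- 2 * e) \<cdot> \<xx> (i + 1))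
      else if j = i then qq powi (- e) \<odot>\<^bsub>A\<^esub>
        (\<mm> i [^]\<^bsub>A\<^esub> (- e) \<cdot> \<mm> (i + 1) [^]\<^bsub>A\<^esub> (- e) \<cdot> \<xx> i) else \<xx> j)"
  using i j
  by (auto simp: inverse_twists_formulas[OF T j pair_side_conditions[OF i] j]
      pair_exponents_def pair_scalar_D_def pair_scalar_X_def relabel_def neg_def one_smult
      power_int_minus A.m_assoc)

lemma q_weyl_eq: "q_weyl r c = A"
  by (simp add: q_weyl_def)

lemma weyl_elt_eq: "weyl_elt r c g = cls (gen g)"
  by (simp add: weyl_elt_def presented_gen_eq)

end

section \<open>Braid automorphisms for even and odd \<open>n\<close>\<close>

theorem theorem3p4:
  fixes r :: nat and e :: int
  assumes "r \<ge> 1" and "e \<in> {1, -1}"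
  shows
    "(let A = q_weyl r (c_even r);
          \<dd> = (\<lambda>i. weyl_elt r (c_even r) (D i));
          \<xx> = (\<lambda>i. weyl_elt r (c_even r) (X i));
          \<mm> = (\<lambda>i. weyl_elt r (c_even r) (M i))
      in \<exists>T' T'' :: nat \<Rightarrow> int \<Rightarrow> weyl_elt \<Rightarrow> weyl_elt. \<forall>i\<in>{1..r}.
        T' i e \<in> alg_aut A \<and> T'' i (-e) \<in> alg_aut A \<and>
        (\<forall>j\<in>{1..r+1}.
          T' i e (\<mm> j) =
            (if i \<noteq> r \<and> j = i + 1 then \<mm> i
             else if i \<noteq> r \<and> j = i then \<mm> (i+1)
             else \<mm> j) \<and>
          T'' i (-e) (\<mm> j) =
            (if i \<noteq> r \<and> j = i + 1 then \<mm> i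
             else if i \<noteq> r \<and> j = i then \<mm> (i+1)
             else \<mm> j) \<and>
          T' i e (\<dd> j) =
            (if i = r \<and> j = r + 1 then
               qq powi e \<odot>\<^bsub>A\<^esub> (\<mm> r [^]\<^bsub>A\<^esub> (-2*e) \<otimes>\<^bsub>A\<^esub> \<dd> (r+1))
             else if i = r \<and> j = r then
               qq powi (-2*e) \<odot>\<^bsub>A\<^esub> (\<mm> r [^]\<^bsub>A\<^esub> (-e) \<otimes>\<^bsub>A\<^esub> \<mm> (r+1) [^]\<^bsub>A\<^esub> (-e) \<otimes>\<^bsub>A\<^esub> \<dd> r)
             else if i \<noteq> r \<and> j = i + 1 then
               (- (qq powi (-e))) \<odot>\<^bsub>A\<^esub> (\<mm> (i+1) [^]\<^bsub>A\<^esub> (-e) \<otimes>\<^bsub>A\<^esub> \<dd> i)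
             else if i = j \<and> j \<noteq> r then
               \<mm> i [^]\<^bsub>A\<^esub> (-e) \<otimes>\<^bsub>A\<^esub> \<dd> (i+1)
             else \<dd> j) \<and>
          T' i e (\<xx> j) =
            (if i = r \<and> j = r + 1 then
               qq powi (-e) \<odot>\<^bsub>A\<^esub> (\<mm> r [^]\<^bsub>A\<^esub> (2*e) \<otimes>\<^bsub>A\<^esub> \<xx> (r+1))
             else if i = r \<and> j = r then
               qq powi e \<odot>\<^bsub>A\<^esub> (\<mm> r [^]\<^bsub>A\<^esub> e \<otimes>\<^bsub>A\<^esub> \<mm> (r+1) [^]\<^bsub>A\<^esub> e \<otimes>\<^bsub>A\<^esub> \<xx> r)
             else if i \<noteq> r \<and> j = i + 1 then
               (- (qq powi e)) \<odot>\<^bsub>A\<^esub> (\<mm> (i+1) [^]\<^bsub>A\<^esub> e \<otimes>\<^bsub>A\<^esub> \<xx> i)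
             else if i = j \<and> j \<noteq> r then
               \<mm> i [^]\<^bsub>A\<^esub> e \<otimes>\<^bsub>A\<^esub> \<xx> (i+1)
             else \<xx> j) \<and>
          T'' i (-e) (\<dd> j) =
            (if i = r \<and> j = r + 1 then
               qq powi (-e) \<odot>\<^bsub>A\<^esub> (\<mm> r [^]\<^bsub>A\<^esub> (2*e) \<otimes>\<^bsub>A\<^esub> \<dd> (r+1))
             else if i = r \<and> j = r then
               qq powi (2*e) \<odot>\<^bsub>A\<^esub> (\<mm> r [^]\<^bsub>A\<^esub> e \<otimes>\<^bsub>A\<^esub> \<mm> (r+1) [^]\<^bsub>A\<^esub> e \<otimes>\<^bsub>A\<^esub> \<dd> r)
             else if i \<noteq> r \<and> j = i + 1 then
               \<mm> (i+1) [^]\<^bsub>A\<^esub> e \<otimes>\<^bsub>A\<^esub> \<dd> i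
             else if i = j \<and> j \<noteq> r then
               (- (qq powi e)) \<odot>\<^bsub>A\<^esub> (\<mm> i [^]\<^bsub>A\<^esub> e \<otimes>\<^bsub>A\<^esub> \<dd> (i+1))
             else \<dd> j) \<and>
          T'' i (-e) (\<xx> j) =
            (if i = r \<and> j = r + 1 then
               qq powi e \<odot>\<^bsub>A\<^esub> (\<mm> r [^]\<^bsub>A\<^esub> (-2*e) \<otimes>\<^bsub>A\<^esub> \<xx> (r+1))
             else if i = r \<and> j = r then
               qq powi (-e) \<odot>\<^bsub>A\<^esub> (\<mm> r [^]\<^bsub>A\<^esub> (-e) \<otimes>\<^bsub>A\<^esub> \<mm> (r+1) [^]\<^bsub>A\<^esub> (-e) \<otimes>\<^bsub>A\<^esub> \<xx> r)
             else if i \<noteq> r \<and> j = i + 1 then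
               \<mm> (i+1) [^]\<^bsub>A\<^esub> (-e) \<otimes>\<^bsub>A\<^esub> \<xx> i
             else if i = j \<and> j \<noteq> r then
               (- (qq powi (-e))) \<odot>\<^bsub>A\<^esub> (\<mm> i [^]\<^bsub>A\<^esub> (-e) \<otimes>\<^bsub>A\<^esub> \<xx> (i+1))
             else \<xx> j)) \<and>
        (\<forall>a\<in>carrier A. T' i e (T'' i (-e) a) = a \<and> T'' i (-e) (T' i e a) = a))
     \<and>
     (let A = q_weyl r (c_odd r);
          \<dd> = (\<lambda>i. weyl_elt r (c_odd r) (D i));
          \<xx> = (\<lambda>i. weyl_elt r (c_odd r) (X i));
          \<mm> = (\<lambda>i. weyl_elt r (c_odd r) (M i))
      in \<exists>T' T'' :: nat \<Rightarrow> int \<Rightarrow> weyl_elt \<Rightarrow> weyl_elt. \<forall>i\<in>{1..r+1}.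
        T' i e \<in> alg_aut A \<and> T'' i (-e) \<in> alg_aut A \<and>
        (\<forall>j\<in>{1..r+1}.
          T' i e (\<mm> j) =
            (if j = i + 1 then \<mm> i
             else if j = i \<and> i \<noteq> r + 1 then \<mm> (i+1)
             else \<mm> j) \<and>
          T'' i (-e) (\<mm> j) =
            (if j = i + 1 then \<mm> i
             else if j = i \<and> i \<noteq> r + 1 then \<mm> (i+1)
             else \<mm> j) \<and>
          T' i e (\<dd> j) =
            (if i = r + 1 \<and> j = r + 1 then
               \<mm> (r+1) [^]\<^bsub>A\<^esub> (-e) \<otimes>\<^bsub>A\<^esub> \<dd> (r+1)
             else if j = i + 1 then
               (- (qq powi (-e))) \<odot>\<^bsub>A\<^esub> (\<mm> (i+1) [^]\<^bsub>A\<^esub> (-e) \<otimes>\<^bsub>A\<^esub> \<dd> i)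
             else if i = j \<and> j \<noteq> r + 1 then
               \<mm> i [^]\<^bsub>A\<^esub> (-e) \<otimes>\<^bsub>A\<^esub> \<dd> (i+1)
             else \<dd> j) \<and>
          T' i e (\<xx> j) =
            (if i = r + 1 \<and> j = r + 1 then
               qq powi (-e) \<odot>\<^bsub>A\<^esub> (\<mm> (r+1) [^]\<^bsub>A\<^esub> e \<otimes>\<^bsub>A\<^esub> \<xx> (r+1))
             else if j = i + 1 then
               (- (qq powi e)) \<odot>\<^bsub>A\<^esub> (\<mm> (i+1) [^]\<^bsub>A\<^esub> e \<otimes>\<^bsub>A\<^esub> \<xx> i)
             else if i = j \<and> j \<noteq> r + 1 then
               \<mm> i [^]\<^bsub>A\<^esub> e \<otimes>\<^bsub>A\<^esub> \<xx> (i+1)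
             else \<xx> j) \<and>
          T'' i (-e) (\<dd> j) =
            (if i = r + 1 \<and> j = r + 1 then
               \<mm> (r+1) [^]\<^bsub>A\<^esub> e \<otimes>\<^bsub>A\<^esub> \<dd> (r+1)
             else if j = i + 1 then
               \<mm> (i+1) [^]\<^bsub>A\<^esub> e \<otimes>\<^bsub>A\<^esub> \<dd> i
             else if i = j \<and> j \<noteq> r + 1 then
               (- (qq powi e)) \<odot>\<^bsub>A\<^esub> (\<mm> i [^]\<^bsub>A\<^esub> e \<otimes>\<^bsub>A\<^esub> \<dd> (i+1))
             else \<dd> j) \<and>
          T'' i (-e) (\<xx> j) =
            (if i = r + 1 \<and> j = r + 1 then
               qq powi e \<odot>\<^bsub>A\<^esub> (\<mm> (r+1) [^]\<^bsub>A\<^esub> (-e) \<otimes>\<^bsub>A\<^esub> \<xx> (r+1))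
             else if j = i + 1 then
               \<mm> (i+1) [^]\<^bsub>A\<^esub> (-e) \<otimes>\<^bsub>A\<^esub> \<xx> i
             else if i = j \<and> j \<noteq> r + 1 then
               (- (qq powi (-e))) \<odot>\<^bsub>A\<^esub> (\<mm> i [^]\<^bsub>A\<^esub> (-e) \<otimes>\<^bsub>A\<^esub> \<xx> (i+1))
             else \<xx> j)) \<and>
        (\<forall>a\<in>carrier A. T' i e (T'' i (-e) a) = a \<and> T'' i (-e) (T' i e a) = a))"
proof (rule conjI, goal_cases even odd)
  case even
  interpret W: weyl_alg r "c_even r" .
  let ?pair = "\<lambda>T T' i. W.inverse_twists T T' (\<lambda>j. j) (pair_scalar_D i e) (pair_scalar_X i e)
    (pair_exponents i e)"
  let ?swap = "\<lambda>T T' i. W.inverse_twists T T' (transpose i (i + 1)) (swap_scalar i (- e))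
    (swap_scalar i e) (swap_exponents i e)"
  have mem: "i \<in> W.index" "i + 1 \<in> W.index" if "i \<in> {1..r}" for i
    using that by (auto simp: W.index_def)
  have "\<exists>T T'. if i = r then ?pair T T' i else ?swap T T' i" if "i \<in> {1..r}" for i
    using W.inverse_twists_exist[OF W.twist_data_pair[OF mem[OF that]]]
      W.inverse_twists_exist[OF W.twist_data_swap[OF mem[OF that]]] that
    by (cases "i = r") (simp_all add: c_even_def)
  then obtain f g where
    fg: "\<And>i. i \<in> {1..r} \<Longrightarrow> if i = r then ?pair (f i) (g i) i else ?swap (f i) (g i) i"
    by metis
  show ?case
    unfolding Let_def W.q_weyl_eq W.weyl_elt_eq
  proof (rule exI[of _ "\<lambda>i _. f i"], rule exI[of _ "\<lambda>i _. g i"], rule ballI, goal_cases)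
    case (1 i)
    show ?case
    proof (cases "i = r")
      case True
      with fg[OF 1] have T: "?pair (f i) (g i) i" by simp
      note formulas = W.pair_formulas[OF mem[OF 1] _ T]
      from T True show ?thesis
        unfolding W.inverse_twists_def W.index_def[symmetric]
        by (simp add: formulas[unfolded True] cong: if_cong)
    next
      case False
      with fg[OF 1] have T: "?swap (f i) (g i) i" by simp
      note formulas = W.swap_formulas[OF mem[OF 1] _ T]
      from T False show ?thesis
        unfolding W.inverse_twists_def W.index_def[symmetric]
        by (simp add: formulas cong: if_cong)
    qed
  qed
next
  case odd
  interpret W: weyl_alg r "c_odd r" .
  let ?self = "\<lambda>T T' i. W.inverse_twists T T' (\<lambda>j. j) (\<lambda>j. 1) (self_scalar i e)
    (self_exponents i e)"
  let ?swap = "\<lambda>T T' i. W.inverse_twists T T' (transpose i (i + 1)) (swap_scalar i (- e))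
    (swap_scalar i e) (swap_exponents i e)"
  have mem: "i \<in> W.index" "i \<noteq> r + 1 \<Longrightarrow> i + 1 \<in> W.index" if "i \<in> {1..r+1}" for i
    using that by (auto simp: W.index_def)
  have "\<exists>T T'. if i = r + 1 then ?self T T' i else ?swap T T' i" if "i \<in> {1..r+1}" for i
    using W.inverse_twists_exist[OF W.twist_data_self[OF mem(1)[OF that]]]
      W.inverse_twists_exist[OF W.twist_data_swap[OF mem[OF that]]]
    by (cases "i = r + 1") (simp_all add: c_odd_def)
  then obtain f g where
    fg: "\<And>i. i \<in> {1..r+1} \<Longrightarrow> if i = r + 1 then ?self (f i) (g i) i else ?swap (f i) (g i) i"
    by metis
  show ?case
    unfolding Let_def W.q_weyl_eq W.weyl_elt_eq
  proof (rule exI[of _ "\<lambda>i _. f i"], rule exI[of _ "\<lambda>i _. g i"], rule ballI, goal_cases)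
    case (1 i)
    show ?case
    proof (cases "i = r + 1")
      case True
      with fg[OF 1] have T: "?self (f i) (g i) i" by simp
      note formulas = W.self_formulas[OF mem(1)[OF 1] _ T]
      \<comment> \<open>At the last node \<open>j = i + 1\<close> is out of range, which rules out the exchange clauses.\<close>
      have "j \<noteq> i + 1" if "j \<in> W.index" for j
        using that True by (auto simp: W.index_def)
      with T True show ?thesis
        unfolding W.inverse_twists_def W.index_def[symmetric]
        by (simp add: formulas[unfolded True Suc_eq_plus1[symmetric]] cong: if_cong)
    next
      case False
      with fg[OF 1] have T: "?swap (f i) (g i) i" by simp
      note formulas = W.swap_formulas[OF mem(1)[OF 1] mem(2)[OF 1 False] _ T]
      from T False show ?thesis
        unfolding W.inverse_twists_def W.index_def[symmetric]
        by (simp add: formulas cong: if_cong)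
    qed
  qed
qed

end
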